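(* Let $q$ be a prime power which is a perfect square, and let $\mathcal{G}$ be the point-line incidence graph of the desarguesian projective plane $\mathrm{PG}(2,q)$. Then the intimacy of $\mathcal{G}$ satisfies $\operatorname{int}(\mathcal{G}) = \left\lfloor \frac{\sqrt{q}-1}{2}\right\rfloor$.
   Context: $\mathrm{PG}(2,q)$ is the projective plane over the finite field $\mathbb{F}_q$: points are the 1-dimensional subspaces and lines are the 2-dimensional subspaces of $\mathbb{F}_q^3$, with incidence given by containment. Its point-line incidence graph is the bipartite graph whose vertex set is the disjoint union of the set of points and the set of lines, a point being adjacent to a line iff they are incident; it is $(q+1)$-regular. For a graph $G$, a vertex $v$ and $U\subseteq V(G)$, $d(v)$ is the degree of $v$ and $d_U(v)$ is the number of neighbours of $v$ in $U$. For an integer $t$, a partition $V(G)=A\cup B$ into two nonempty sets is called $t$-internal if $d_A(v)\ge d(v)/2+t$ for all $v\in A$ and $d_B(v)\ge d(v)/2+t$ for all $v\in B$. The intimacy $\operatorname{int}(G)$ is the maximum integer $t$ for which $G$ has a $t$-internal partition. *)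

theory Defs
  imports
    "HOL-Analysis.Analysis"
    "HOL-Computational_Algebra.Nth_Powers"
    "HOL-Number_Theory.Prime_Powers"
begin

(* A simple graph is a pair of its vertex set and its set of edges, the latter being
   two-element sets of vertices. *)
type_synonym 'v sgraph = "'v set \<times> 'v set set"

abbreviation vertices :: "'v sgraph \<Rightarrow> 'v set" where
  "vertices G \<equiv> fst G"

abbreviation edges :: "'v sgraph \<Rightarrow> 'v set set" where
  "edges G \<equiv> snd G"

definition degree_in :: "'v sgraph \<Rightarrow> 'v set \<Rightarrow> 'v \<Rightarrow> nat" where
  "degree_in G U v = card {w \<in> U. {v, w} \<in> edges G}"

definition vdegree :: "'v sgraph \<Rightarrow> 'v \<Rightarrow> nat" where
  "vdegree G v = degree_in G (vertices G) v"

definition internal_partition :: "'v sgraph \<Rightarrow> int \<Rightarrow> 'v set \<Rightarrow> 'v set \<Rightarrow> bool" where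
  "internal_partition G t A B \<longleftrightarrow>
     A \<union> B = vertices G \<and> A \<inter> B = {} \<and> A \<noteq> {} \<and> B \<noteq> {} \<and>
     (\<forall>v\<in>A. real (degree_in G A v) \<ge> real (vdegree G v) / 2 + real_of_int t) \<and>
     (\<forall>v\<in>B. real (degree_in G B v) \<ge> real (vdegree G v) / 2 + real_of_int t)"

(* The admissible t are unbounded below, so Max, which needs a finite set, cannot be used.
   The maximum exists for every finite graph with at least two vertices: see
   intimacy_attained and intimacy_upper below. *)
definition intimacy :: "'v sgraph \<Rightarrow> int" where
  "intimacy G = (GREATEST t. \<exists>A B. internal_partition G t A B)"

definition pg2_points :: "('a::field ^ 3) set set" where
  "pg2_points = {P. vec.subspace P \<and> vec.dim P = 1}"

definition pg2_lines :: "('a::field ^ 3) set set" where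
  "pg2_lines = {L. vec.subspace L \<and> vec.dim L = 2}"

definition pg2_incidence_graph :: "(('a::field ^ 3) set + ('a ^ 3) set) sgraph" where
  "pg2_incidence_graph =
     (pg2_points <+> pg2_lines,
      {{Inl P, Inr L} | P L. P \<in> pg2_points \<and> L \<in> pg2_lines \<and> P \<subseteq> L})"

lemma internal_partition_le:
  assumes fin: "finite (vertices G)" and ip: "internal_partition G t A B"
  shows "t \<le> int (card (vertices G))"
proof -
  from ip obtain v where v: "v \<in> A" by (auto simp: internal_partition_def)
  have "A \<subseteq> vertices G" using ip by (auto simp: internal_partition_def)
  then have "degree_in G A v \<le> card (vertices G)"
    unfolding degree_in_def using fin by (intro card_mono) auto
  moreover have "real (degree_in G A v) \<ge> real (vdegree G v) / 2 + real_of_int t"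
    using ip v by (auto simp: internal_partition_def)
  ultimately show ?thesis by linarith
qed

lemma internal_partition_exists:
  assumes fin: "finite (vertices G)" and two: "card (vertices G) \<ge> 2"
  shows "\<exists>t A B. internal_partition G t A B"
proof -
  from two obtain a where a: "a \<in> vertices G" by fastforce
  have "vertices G - {a} \<noteq> {}"
    using two a fin by (metis One_nat_def Suc_n_not_le_n card_Diff_singleton card.empty
        diff_is_0_eq numeral_2_eq_2 le_trans)
  moreover have "vdegree G v \<le> card (vertices G)" for v
    unfolding vdegree_def degree_in_def using fin by (intro card_mono) auto
  then have "real (vdegree G v) / 2 + real_of_int (- int (card (vertices G))) \<le> real n" for v n
    by (simp add: field_simps) (smt (verit) of_nat_0_le_iff of_nat_le_iff)
  ultimately have "internal_partition G (- int (card (vertices G))) {a} (vertices G - {a})"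
    using a by (auto simp: internal_partition_def)
  then show ?thesis by blast
qed

lemma intimacy_ex:
  assumes fin: "finite (vertices G)" and two: "card (vertices G) \<ge> 2"
  shows "\<exists>m. (\<exists>A B. internal_partition G m A B) \<and>
             (\<forall>t A B. internal_partition G t A B \<longrightarrow> t \<le> m)"
proof -
  let ?N = "int (card (vertices G))"
  let ?S = "{t. \<exists>A B. internal_partition G t A B}"
  from internal_partition_exists[OF assms] obtain t0 where t0: "t0 \<in> ?S" by blast
  have sub: "?S \<inter> {t0..} \<subseteq> {t0..?N}" using internal_partition_le[OF fin] by auto
  then have f: "finite (?S \<inter> {t0..})" by (rule finite_subset) simp
  define m where "m = Max (?S \<inter> {t0..})"
  have m: "m \<in> ?S \<inter> {t0..}" unfolding m_def using f t0 by (intro Max_in) auto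
  have "t \<le> m" if "t \<in> ?S" for t
  proof (cases "t0 \<le> t")
    case True
    then show ?thesis unfolding m_def using that f by (intro Max_ge) auto
  next
    case False
    then show ?thesis using m by auto
  qed
  with m show ?thesis by blast
qed

lemma intimacy_eqI:
  assumes "internal_partition G m A B"
    and "\<And>t A B. internal_partition G t A B \<Longrightarrow> t \<le> m"
  shows "intimacy G = m"
  unfolding intimacy_def using assms by (intro Greatest_equality) blast+

lemma
  assumes "finite (vertices G)" and "card (vertices G) \<ge> 2"
  shows intimacy_attained: "\<exists>A B. internal_partition G (intimacy G) A B"
    and intimacy_upper: "internal_partition G t A B \<Longrightarrow> t \<le> intimacy G"
proof -
  from intimacy_ex[OF assms] obtain m where
    m: "\<exists>A B. internal_partition G m A B" "\<And>t A B. internal_partition G t A B \<Longrightarrow> t \<le> m"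
    by blast
  then have "intimacy G = m" using intimacy_eqI by metis
  with m show "\<exists>A B. internal_partition G (intimacy G) A B"
    and "internal_partition G t A B \<Longrightarrow> t \<le> intimacy G" by auto
qed

end

theory Submission
  imports Defs "HOL-Computational_Algebra.Polynomial_Factorial"
begin

text \<open>
  Write \<open>q = s\<^sup>2\<close>. The second largest eigenvalue of the incidence graph is \<open>s\<close>, so a set \<open>A\<close> of at
  most half of the vertices has average internal degree at most \<open>(q + 1 + s) / 2\<close>; this bounds
  \<open>t\<close> by \<open>s / 2\<close>, and parity of the degrees gives the upper bound.

  For the lower bound, identify the plane with \<open>K\<^sup>* / F\<^sup>*\<close>, where \<open>F\<close> has order \<open>q\<close> and \<open>K\<close> is
  its cubic extension obtained from a cubic over the subfield \<open>F\<^sub>0\<close> of order \<open>s\<close>. The cosets of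
  \<open>K\<^sub>0\<^sup>* F\<^sup>*\<close>, where \<open>K\<^sub>0\<close> is the cubic extension of \<open>F\<^sub>0\<close>, partition the plane into \<open>q - s + 1\<close>
  Baer subplanes, each met by every line in \<open>1\<close> or \<open>s + 1\<close> points. As a line has \<open>q + 1\<close> points, it
  is secant to exactly one of them, so a union of \<open>k\<close> Baer subplanes meets every line in \<open>k\<close> or
  \<open>k + s\<close> points. With \<open>k = (q - s) / 2\<close>, this union together with the lines meeting it in
  \<open>k + s\<close> points is one side of the required partition.
\<close>

section \<open>Counting in a finite projective plane and the spectral bound on incidences\<close>

locale finite_projective_plane =
  fixes Pts :: "'p set" and Lns :: "'l set" and I :: "'p \<Rightarrow> 'l \<Rightarrow> bool" and q :: nat
  assumes finite_Pts: "finite Pts" and finite_Lns: "finite Lns"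
    and card_Pts: "card Pts = q\<^sup>2 + q + 1"
    and card_line: "l \<in> Lns \<Longrightarrow> card {p \<in> Pts. I p l} = q + 1"
    and ex1_line: "p \<in> Pts \<Longrightarrow> p' \<in> Pts \<Longrightarrow> p \<noteq> p' \<Longrightarrow> \<exists>!l. l \<in> Lns \<and> I p l \<and> I p' l"
    and q_pos: "q > 0"
begin

lemma card_lines_through_two:
  assumes "p \<in> Pts" "p' \<in> Pts" "p \<noteq> p'"
  shows "card {l \<in> Lns. I p l \<and> I p' l} = 1"
  using ex1_line[OF assms] by (auto simp: card_1_singleton_iff)

lemma sum_card_line_inter:
  assumes "finite X" "L \<subseteq> Lns"
  shows "(\<Sum>l\<in>L. card {p \<in> X. I p l}) = (\<Sum>p\<in>X. card {l \<in> L. I p l})"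
  using sum.swap_restrict[OF finite_subset[OF assms(2) finite_Lns] assms(1),
      of "\<lambda>_ _. 1::nat" "\<lambda>l p. I p l"] by simp

text \<open>Double counting: a point of \<open>X\<close> other than \<open>p\<close> lies on exactly
  one line through \<open>p\<close>, while \<open>p\<close> lies on all of them. The number of lines
  through \<open>p\<close> is left open because the case \<open>X = Pts\<close> is what determines
  it.\<close>

lemma sum_lines_through_aux:
  assumes X: "X \<subseteq> Pts" and p: "p \<in> Pts"
  shows "(\<Sum>l\<in>{l \<in> Lns. I p l}. card {p' \<in> X. I p' l})
           = (if p \<in> X then card {l \<in> Lns. I p l} + card X - 1 else card X)"
proof -
  have fX: "finite X" using X finite_Pts finite_subset by blast
  have "(\<Sum>l\<in>{l \<in> Lns. I p l}. card {p' \<in> X. I p' l})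
          = (\<Sum>p'\<in>X. card {l \<in> {l \<in> Lns. I p l}. I p' l})"
    by (rule sum_card_line_inter) (use fX in auto)
  also have "\<dots> = (\<Sum>p'\<in>X. if p = p' then card {l \<in> Lns. I p l} else 1)"
  proof (rule sum.cong)
    fix p' assume "p' \<in> X"
    then show "card {l \<in> {l \<in> Lns. I p l}. I p' l} = (if p = p' then card {l \<in> Lns. I p l} else 1)"
      using card_lines_through_two[OF p, of p'] X by (auto simp: conj_assoc)
  qed simp
  also have "\<dots> = (if p \<in> X then card {l \<in> Lns. I p l} + card X - 1 else card X)"
  proof (cases "p \<in> X")
    case True
    have "card X > 0" using True fX card_gt_0_iff by blast
    then show ?thesis
      by (subst sum.remove[OF fX True], subst sum.cong[where h = "\<lambda>_. 1" and B = "X - {p}"])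
        (use True fX in auto)
  next
    case False
    then have "(\<Sum>p'\<in>X. if p = p' then card {l \<in> Lns. I p l} else 1) = (\<Sum>p'\<in>X. 1)"
      by (intro sum.cong) auto
    then show ?thesis using False by simp
  qed
  finally show ?thesis .
qed

lemma card_lines_through:
  assumes p: "p \<in> Pts"
  shows "card {l \<in> Lns. I p l} = q + 1"
proof -
  have "(\<Sum>l\<in>{l \<in> Lns. I p l}. card {p' \<in> Pts. I p' l}) = card {l \<in> Lns. I p l} + (q\<^sup>2 + q)"
    using sum_lines_through_aux[OF order_refl p] p card_Pts by simp
  then have "card {l \<in> Lns. I p l} * (q + 1) = card {l \<in> Lns. I p l} + (q\<^sup>2 + q)"
    using card_line by simp
  then have "q * card {l \<in> Lns. I p l} = q * (q + 1)"
    by (simp add: algebra_simps power2_eq_square)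
  then show ?thesis using q_pos by (metis mult_cancel1 less_irrefl)
qed

lemma sum_lines_through:
  assumes X: "X \<subseteq> Pts" and p: "p \<in> Pts"
  shows "(\<Sum>l\<in>{l \<in> Lns. I p l}. card {p' \<in> X. I p' l}) = card X + (if p \<in> X then q else 0)"
proof -
  have "card X > 0" if "p \<in> X" using that X finite_Pts card_gt_0_iff finite_subset by blast
  then show ?thesis using sum_lines_through_aux[OF X p] card_lines_through[OF p] by simp
qed

lemma sum_card_line:
  assumes "X \<subseteq> Pts"
  shows "(\<Sum>l\<in>Lns. card {p \<in> X. I p l}) = card X * (q + 1)"
proof -
  have "(\<Sum>l\<in>Lns. card {p \<in> X. I p l}) = (\<Sum>p\<in>X. card {l \<in> Lns. I p l})"
    by (rule sum_card_line_inter) (use assms finite_Pts finite_subset in auto)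
  also have "\<dots> = (\<Sum>p\<in>X. q + 1)" using assms card_lines_through by (intro sum.cong) auto
  finally show ?thesis by simp
qed

lemma card_Lns: "card Lns = q\<^sup>2 + q + 1"
proof -
  have "card Lns * (q + 1) = (q\<^sup>2 + q + 1) * (q + 1)"
    using sum_card_line[OF order_refl] card_line by (simp add: card_Pts)
  then show ?thesis by (metis mult_cancel2 add_is_0 one_neq_zero)
qed

text \<open>Weighting every point of \<open>l\<close> in \<open>X\<close> by the size of that
  intersection and summing by points first turns the second moment into the sums over pencils
  computed above.\<close>

lemma sum_card_line_square:
  assumes X: "X \<subseteq> Pts"
  shows "(\<Sum>l\<in>Lns. (card {p \<in> X. I p l})\<^sup>2) = card X * (card X + q)"
proof -
  have fX: "finite X" using X finite_Pts finite_subset by blast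
  have "(\<Sum>l\<in>Lns. (card {p \<in> X. I p l})\<^sup>2)
          = (\<Sum>l\<in>Lns. \<Sum>p\<in>{p \<in> X. I p l}. card {p \<in> X. I p l})"
    by (simp add: power2_eq_square)
  also have "\<dots> = (\<Sum>p\<in>X. \<Sum>l\<in>{l \<in> Lns. I p l}. card {p \<in> X. I p l})"
    by (rule sum.swap_restrict[OF finite_Lns fX])
  also have "\<dots> = (\<Sum>p\<in>X. card X + q)"
    using X sum_lines_through[OF X] by (intro sum.cong) (auto simp: subset_iff)
  finally show ?thesis by simp
qed

text \<open>The incidence matrix has singular value \<open>q + 1\<close> on constant vectors and
  \<open>s\<close> on vectors of sum zero. This is the expander mixing estimate after the
  arithmetic-geometric mean inequality. Instead of diagonalising, the proof expands the squared norm
  of \<open>s\<close> times the indicator of \<open>Y\<close> minus the vector of line intersections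
  with \<open>X\<close>, made orthogonal to the constants by \<open>c\<close>.\<close>

lemma incidence_bound:
  assumes X: "X \<subseteq> Pts" and Y: "Y \<subseteq> Lns" and s: "s > 0" "s\<^sup>2 = real q"
  defines "a \<equiv> real (card X)" and "b \<equiv> real (card Y)" and "n \<equiv> real (q\<^sup>2 + q + 1)"
    and "e \<equiv> real (\<Sum>l\<in>Y. card {p \<in> X. I p l})"
  shows "2 * e \<le> s * (a + b) + (2 * (real q + 1) * a * b - s * (a\<^sup>2 + b\<^sup>2)) / n"
proof -
  define d where "d l = real (card {p \<in> X. I p l})" for l
  define ind where "ind l = (if l \<in> Y then 1 else 0 :: real)" for l
  \<comment> \<open>the shift that minimises the sum of squares below\<close>
  define c where "c = ((real q + 1) * a - s * b) / n"
  have n0: "n > 0" and nq: "n = real q ^ 2 + real q + 1" by (simp_all add: n_def add_pos_nonneg add.commute)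
  have Yi: "Lns \<inter> Y = Y" using Y by blast
  have S1: "(\<Sum>l\<in>Lns. d l) = a * (real q + 1)"
    using arg_cong[OF sum_card_line[OF X], of real] by (simp add: d_def a_def algebra_simps)
  have S2: "(\<Sum>l\<in>Lns. (d l)\<^sup>2) = a * (a + real q)"
    using arg_cong[OF sum_card_line_square[OF X], of real] by (simp add: d_def a_def algebra_simps)
  have S3: "(\<Sum>l\<in>Lns. ind l) = b" using finite_Lns Yi by (simp add: ind_def b_def sum.If_cases Int_def)
  have S4: "(\<Sum>l\<in>Lns. ind l * d l) = e"
  proof -
    have "(\<Sum>l\<in>Lns. ind l * d l) = (\<Sum>l\<in>Lns. if l \<in> Y then d l else 0)"
      by (intro sum.cong) (auto simp: ind_def)
    also have "\<dots> = (\<Sum>l\<in>Lns \<inter> Y. d l)" by (rule sum.inter_restrict[OF finite_Lns, symmetric])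
    finally show ?thesis by (simp add: Yi e_def d_def)
  qed
  have "0 \<le> (\<Sum>l\<in>Lns. (s * ind l - d l + c)\<^sup>2)" by (intro sum_nonneg) simp
  also have "\<dots> = (\<Sum>l\<in>Lns. real q * ind l - 2 * s * (ind l * d l) + (d l)\<^sup>2 + 2 * c * s * ind l - 2 * c * d l + c\<^sup>2)"
    by (intro sum.cong) (auto simp: ind_def s(2)[symmetric] power2_eq_square algebra_simps)
  also have "\<dots> = real q * b - 2 * s * e + a * (a + real q) + 2 * c * s * b - 2 * c * (a * (real q + 1)) + n * c\<^sup>2"
    by (simp add: sum.distrib sum_subtractf sum_distrib_left[symmetric] S1 S2 S3 S4 card_Lns n_def)
  also have "\<dots> = real q * (a + b) + a\<^sup>2 - 2 * s * e - ((real q + 1) * a - s * b)\<^sup>2 / n"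
    using n0 by (simp add: c_def power2_eq_square field_simps)
  finally have "2 * s * e \<le> real q * (a + b) + a\<^sup>2 - ((real q + 1) * a - s * b)\<^sup>2 / n" by simp
  also have "\<dots> = s * (s * (a + b) + (2 * (real q + 1) * a * b - s * (a\<^sup>2 + b\<^sup>2)) / n)"
  proof -
    \<comment> \<open>Since \<open>n - (q + 1)^2 = -q = -s^2\<close>, a factor \<open>s\<close>
      splits off; it is cancelled at the end.\<close>
    have "n * a\<^sup>2 - ((real q + 1) * a - s * b)\<^sup>2 = s * (2 * (real q + 1) * a * b - s * (a\<^sup>2 + b\<^sup>2))"
      unfolding nq s(2)[symmetric] by algebra
    then have "a\<^sup>2 - ((real q + 1) * a - s * b)\<^sup>2 / n = s * (2 * (real q + 1) * a * b - s * (a\<^sup>2 + b\<^sup>2)) / n"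
      using n0 by (simp add: field_simps)
    then show ?thesis using s(2) by (simp add: algebra_simps power2_eq_square)
  qed
  finally have "s * (2 * e) \<le> s * (s * (a + b) + (2 * (real q + 1) * a * b - s * (a\<^sup>2 + b\<^sup>2)) / n)"
    by (simp add: mult_ac)
  then show ?thesis using s(1) mult_le_cancel_left_pos by blast
qed

text \<open>Summing the degree condition over both \<open>X\<close> and \<open>Y\<close> counts
  every incidence twice, so \<open>incidence_bound\<close> limits the average degree. Here
  \<open>m\<close> is twice the excess over half the degree, which keeps half-integral excesses
  available.\<close>

lemma small_part_degree_bound:
  assumes X: "X \<subseteq> Pts" and Y: "Y \<subseteq> Lns" and s: "s > 0" "s\<^sup>2 = real q"
    and nonempty: "X \<noteq> {} \<or> Y \<noteq> {}"
    and small: "card X + card Y \<le> q\<^sup>2 + q + 1"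
    and degX: "\<And>p. p \<in> X \<Longrightarrow> real q + 1 + m \<le> 2 * real (card {l \<in> Y. I p l})"
    and degY: "\<And>l. l \<in> Y \<Longrightarrow> real q + 1 + m \<le> 2 * real (card {p \<in> X. I p l})"
  shows "m \<le> s"
proof -
  have fX: "finite X" and fY: "finite Y" using X Y finite_Pts finite_Lns finite_subset by blast+
  define a b n N where "a = real (card X)" and "b = real (card Y)" and "n = real (q\<^sup>2 + q + 1)"
    and "N = a + b"
  define e where "e = real (\<Sum>l\<in>Y. card {p \<in> X. I p l})"
  have N0: "N > 0" using nonempty fX fY card_gt_0_iff[of X] card_gt_0_iff[of Y]
    by (auto simp: N_def a_def b_def add_pos_nonneg add_nonneg_pos simp del: card_gt_0_iff card_0_eq)
  have Nn: "N \<le> n" using small unfolding N_def a_def b_def n_def by linarith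
  have n0: "n > 0" using N0 Nn by simp
  have e2: "e = real (\<Sum>p\<in>X. card {l \<in> Y. I p l})"
    unfolding e_def using sum_card_line_inter[OF fX Y] by simp
  have "b * (real q + 1 + m) = (\<Sum>l\<in>Y. real q + 1 + m)" by (simp add: b_def)
  also have "\<dots> \<le> (\<Sum>l\<in>Y. 2 * real (card {p \<in> X. I p l}))" by (intro sum_mono degY)
  also have "\<dots> = 2 * e" by (simp add: e_def sum_distrib_left)
  finally have 1: "b * (real q + 1 + m) \<le> 2 * e" .
  have "a * (real q + 1 + m) = (\<Sum>p\<in>X. real q + 1 + m)" by (simp add: a_def)
  also have "\<dots> \<le> (\<Sum>p\<in>X. 2 * real (card {l \<in> Y. I p l}))" by (intro sum_mono degX)
  also have "\<dots> = 2 * e" by (simp add: e2 sum_distrib_left)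
  finally have "N * (real q + 1 + m) \<le> 2 * (2 * e)" using 1 by (simp add: N_def algebra_simps)
  also have "2 * e \<le> s * N + (2 * (real q + 1) * a * b - s * (a\<^sup>2 + b\<^sup>2)) / n"
    using incidence_bound[OF X Y s] by (simp only: N_def a_def b_def n_def e_def)
  also have "2 * (real q + 1) * a * b - s * (a\<^sup>2 + b\<^sup>2) \<le> (real q + 1 - s) * N\<^sup>2 / 2"
  proof -
    \<comment> \<open>Half of this quantity is exactly the gap in the claim: for a given total
      \<open>N\<close> the balanced case \<open>a = b\<close> is the worst.\<close>
    have "0 \<le> (real q + 1 + s) * (a - b)\<^sup>2" using s(1) by simp
    then show ?thesis by (simp add: N_def power2_eq_square algebra_simps)
  qed
  also have "(real q + 1 - s) * N\<^sup>2 / 2 \<le> (real q + 1 - s) * (N * n) / 2"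
  proof -
    have "s \<le> real q + 1"
      using s(2) sum_squares_bound[of s 1] s(1) by (simp add: power2_eq_square)
    \<comment> \<open>The part being at most half of the vertices enters here; the coefficient
      \<open>q + 1 - s\<close> must be nonnegative for the estimate to keep its direction.\<close>
    moreover have "N\<^sup>2 \<le> N * n" using N0 Nn by (simp add: power2_eq_square)
    ultimately show ?thesis by (intro divide_right_mono mult_left_mono) auto
  qed
  finally have "N * (real q + 1 + m) \<le> 2 * (s * N + (real q + 1 - s) * (N * n) / 2 / n)"
    using n0 by (simp add: divide_right_mono)
  also have "\<dots> = N * (real q + 1 + s)" using n0 by (simp add: field_simps)
  finally show ?thesis using N0 by simp
qed

end

section \<open>Counting by fibres and cardinalities of subspaces\<close>

lemma card_eq_card_image_times_fibre:
  assumes "finite A" and "\<And>x. x \<in> A \<Longrightarrow> card {y \<in> A. f y = f x} = m"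
  shows "card A = card (f ` A) * m"
proof -
  have "card A = (\<Sum>x\<in>A. 1)" by simp
  also have "\<dots> = (\<Sum>z\<in>f ` A. \<Sum>y\<in>{y \<in> A. f y = z}. 1)" by (rule sum.image_gen[OF assms(1)])
  also have "\<dots> = (\<Sum>z\<in>f ` A. m)" using assms(2) by (intro sum.cong) auto
  finally show ?thesis by simp
qed

text \<open>Every nonempty fibre is a translate of the kernel. It serves as a substitute for
  rank-nullity for maps that are merely additive, such as the Frobenius map minus the
  identity.\<close>

lemma card_additive_image:
  fixes f :: "'g::ab_group_add \<Rightarrow> 'h::ab_group_add"
  assumes fin: "finite H" and diff: "\<And>x y. x \<in> H \<Longrightarrow> y \<in> H \<Longrightarrow> x - y \<in> H"
    and hom: "\<And>x y. x \<in> H \<Longrightarrow> y \<in> H \<Longrightarrow> f (x - y) = f x - f y"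
  shows "card H = card (f ` H) * card {x \<in> H. f x = 0}"
proof (rule card_eq_card_image_times_fibre[OF fin])
  fix x assume x: "x \<in> H"
  have "{y \<in> H. f y = f x} = (\<lambda>k. x - k) ` {k \<in> H. f k = 0}"
  proof (intro equalityI subsetI)
    fix y assume "y \<in> {y \<in> H. f y = f x}"
    then show "y \<in> (\<lambda>k. x - k) ` {k \<in> H. f k = 0}"
      using x diff hom by (intro image_eqI[of _ _ "x - y"]) auto
  qed (use x diff hom in auto)
  then show "card {y \<in> H. f y = f x} = card {x \<in> H. f x = 0}"
    by (simp add: card_image inj_on_def)
qed

lemma card_subspace:
  fixes V :: "('a::{field,finite} ^ 'n) set"
  assumes "vec.subspace V"
  shows "card V = CARD('a) ^ vec.dim V"
proof -
  have *: "card (vec.span B) = CARD('a) ^ card B" if "finite B" "vec.independent B" for B :: "('a ^ 'n) set"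
    using that
  proof (induction B rule: finite_induct)
    case (insert b B)
    then have ind: "vec.independent B" and b: "b \<notin> vec.span B"
      by (auto simp: vec.independent_insert)
    have "vec.span (insert b B) = (\<lambda>(k, x). k *s b + x) ` (UNIV \<times> vec.span B)"
    proof (intro equalityI subsetI)
      fix x assume "x \<in> vec.span (insert b B)"
      then obtain k where "x - k *s b \<in> vec.span B" by (auto simp: vec.span_insert)
      then show "x \<in> (\<lambda>(k, x). k *s b + x) ` (UNIV \<times> vec.span B)"
        by (intro image_eqI[of _ _ "(k, x - k *s b)"]) auto
    next
      fix x assume "x \<in> (\<lambda>(k, x). k *s b + x) ` (UNIV \<times> vec.span B)"
      then obtain k y where "y \<in> vec.span B" "x = k *s b + y" by auto
      then have "x - k *s b \<in> vec.span B" by simp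
      then show "x \<in> vec.span (insert b B)" by (auto simp: vec.span_insert)
    qed
    moreover have "inj_on (\<lambda>(k, x). k *s b + x) (UNIV \<times> vec.span B)"
    proof (rule inj_onI, clarsimp)
      fix k k' x x' assume x: "x \<in> vec.span B" "x' \<in> vec.span B" and eq: "k *s b + x = k' *s b + x'"
      have eq': "(k - k') *s b = x' - x" using eq by (simp add: algebra_simps)
      have "k = k'"
      proof (rule ccontr)
        assume "k \<noteq> k'"
        then have "b = inverse (k - k') *s ((k - k') *s b)"
          by (simp only: vec.scale_scale left_inverse right_minus_eq vec.scale_one not_False_eq_True)
        also have "\<dots> \<in> vec.span B" unfolding eq' using x by (intro vec.span_scale vec.span_diff)
        finally show False using b by simp
      qed
      then show "k = k' \<and> x = x'" using eq by simp
    qed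
    ultimately show ?case using insert ind by (simp add: card_image card_cartesian_product)
  qed simp
  obtain B where "finite B" "vec.independent B" "vec.span B = V" "card B = vec.dim V"
    using vec.basis_subspace_exists[OF assms] by metis
  then show ?thesis using * by metis
qed

section \<open>Points and lines of PG(2,q)\<close>

lemma span_singleton_eq_iff:
  fixes x y :: "'a::field ^ 'n"
  assumes "x \<noteq> 0"
  shows "vec.span {x} = vec.span {y} \<longleftrightarrow> (\<exists>a. a \<noteq> 0 \<and> x = a *s y)"
proof
  assume "vec.span {x} = vec.span {y}"
  then have "x \<in> vec.span {y}" using vec.span_base[of x "{x}"] by simp
  then show "\<exists>a. a \<noteq> 0 \<and> x = a *s y" using assms by (auto simp: vec.span_singleton)
next
  assume "\<exists>a. a \<noteq> 0 \<and> x = a *s y"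
  then obtain a where a: "a \<noteq> 0" "x = a *s y" by blast
  then have "y = inverse a *s x" by simp
  then have "y \<in> vec.span {x}" unfolding vec.span_singleton by (rule range_eqI)
  moreover have "x \<in> vec.span {y}" unfolding vec.span_singleton using a(2) by (rule range_eqI)
  ultimately show "vec.span {x} = vec.span {y}"
    by (intro subset_antisym vec.span_minimal) auto
qed

lemma span_singleton_in_points: "x \<noteq> 0 \<Longrightarrow> vec.span {x} \<in> pg2_points"
  by (simp add: pg2_points_def)

lemma points_spanE:
  assumes "P \<in> pg2_points"
  obtains x where "x \<noteq> 0" "P = vec.span {x}"
proof -
  from assms have P: "vec.subspace P" "vec.dim P = 1" by (auto simp: pg2_points_def)
  then obtain B where "vec.span B = P" "card B = 1" using vec.basis_subspace_exists by metis
  then obtain x where x: "vec.span {x} = P" by (auto simp: card_1_singleton_iff)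
  moreover have "x \<noteq> 0" using x P by (metis vec.dim_singleton vec.dim_span zero_neq_one)
  ultimately show ?thesis using that by blast
qed

lemma span_singleton_subset_iff:
  "vec.subspace V \<Longrightarrow> vec.span {x} \<subseteq> V \<longleftrightarrow> x \<in> V"
  using vec.span_base[of x "{x}"] vec.span_minimal[of "{x}" V] by auto

text \<open>The nonzero vectors spanning a given point are the nonzero multiples of any one of them,
  so the fibres of the span map have size \<open>CARD('a) - 1\<close>.\<close>

lemma card_points_in_subspace:
  fixes V :: "('a::{field,finite} ^ 3) set"
  assumes V: "vec.subspace V"
  shows "card V - 1 = card {P \<in> pg2_points. P \<subseteq> V} * (CARD('a) - 1)"
proof -
  have 0: "0 \<in> V" using V by (rule vec.subspace_0)
  have img: "(\<lambda>x. vec.span {x}) ` (V - {0}) = {P \<in> pg2_points. P \<subseteq> V}"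
  proof (intro equalityI subsetI)
    fix P assume P: "P \<in> {P \<in> pg2_points. P \<subseteq> V}"
    then obtain x where "x \<noteq> 0" "P = vec.span {x}" using points_spanE by blast
    then show "P \<in> (\<lambda>x. vec.span {x}) ` (V - {0})"
      using P span_singleton_subset_iff[OF V] by auto
  next
    fix P assume "P \<in> (\<lambda>x. vec.span {x}) ` (V - {0})"
    then show "P \<in> {P \<in> pg2_points. P \<subseteq> V}"
      using span_singleton_in_points span_singleton_subset_iff[OF V] by blast
  qed
  have "card (V - {0}) = card ((\<lambda>x. vec.span {x}) ` (V - {0})) * (CARD('a) - 1)"
  proof (rule card_eq_card_image_times_fibre)
    fix x assume x: "x \<in> V - {0}"
    have "{y \<in> V - {0}. vec.span {y} = vec.span {x}} = (\<lambda>a. a *s x) ` (UNIV - {0})"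
    proof (intro equalityI subsetI)
      fix y assume "y \<in> {y \<in> V - {0}. vec.span {y} = vec.span {x}}"
      then show "y \<in> (\<lambda>a. a *s x) ` (UNIV - {0})" using span_singleton_eq_iff[of y x] by auto
    next
      fix y assume "y \<in> (\<lambda>a. a *s x) ` (UNIV - {0})"
      then obtain a where a: "a \<noteq> 0" "y = a *s x" by auto
      then have "y \<noteq> 0" "y \<in> V" using x vec.subspace_scale[OF V] by auto
      then show "y \<in> {y \<in> V - {0}. vec.span {y} = vec.span {x}}"
        using span_singleton_eq_iff[of y x] a by auto
    qed
    moreover have "inj_on (\<lambda>a. a *s x) (UNIV - {0})"
      using x by (auto simp: inj_on_def)
    ultimately show "card {y \<in> V - {0}. vec.span {y} = vec.span {x}} = CARD('a) - 1"
      by (simp add: card_image card_Diff_singleton)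
  qed simp
  then show ?thesis using 0 by (simp add: img card_Diff_singleton)
qed

lemma pg2_ex1_line:
  fixes P P' :: "('a::field ^ 3) set"
  assumes P: "P \<in> pg2_points" "P' \<in> pg2_points" "P \<noteq> P'"
  shows "\<exists>!L. L \<in> pg2_lines \<and> P \<subseteq> L \<and> P' \<subseteq> L"
proof -
  obtain x y where x: "x \<noteq> 0" "P = vec.span {x}" and y: "y \<noteq> 0" "P' = vec.span {y}"
    using P points_spanE by metis
  have nx: "x \<notin> vec.span {y}"
    using P(3) x y span_singleton_eq_iff[OF x(1), of y] by (auto simp: vec.span_singleton)
  have dim: "vec.dim {x, y} = 2" using nx y by (simp add: vec.dim_insert)
  show ?thesis
  proof (rule ex1I)
    show "vec.span {x, y} \<in> pg2_lines \<and> P \<subseteq> vec.span {x, y} \<and> P' \<subseteq> vec.span {x, y}"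
      using dim x y by (auto simp: pg2_lines_def intro!: vec.span_mono)
  next
    fix L assume L: "L \<in> pg2_lines \<and> P \<subseteq> L \<and> P' \<subseteq> L"
    then have sL: "vec.subspace L" and dL: "vec.dim L = 2" by (auto simp: pg2_lines_def)
    have "vec.span {x, y} \<subseteq> L"
      using L sL x y span_singleton_subset_iff by (intro vec.span_minimal) auto
    then show "L = vec.span {x, y}"
      using vec.subspace_dim_equal[OF vec.subspace_span sL] dim dL by (metis order_refl vec.dim_span)
  qed
qed

lemma CARD_field_ge_2: "CARD('a::{field,finite}) \<ge> 2"
proof -
  have "card {0::'a, 1} \<le> CARD('a)" by (rule card_mono) auto
  then show ?thesis by simp
qed

lemma card_points_of_dim:
  fixes V :: "('a::{field,finite} ^ 3) set"
  assumes "vec.subspace V"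
  shows "card {P \<in> pg2_points. P \<subseteq> V} = (\<Sum>i<vec.dim V. CARD('a) ^ i)"
proof -
  have "(\<Sum>i<d. m ^ i) * (m - 1) = m ^ d - 1" if "m \<ge> 2" for m d :: nat
  proof (induction d)
    case (Suc d)
    have "(\<Sum>i<Suc d. m ^ i) * (m - 1) = (m ^ d - 1) + m ^ d * (m - 1)"
      using Suc by (simp only: sum.lessThan_Suc distrib_right)
    also have "\<dots> = m ^ Suc d - 1" using that by (simp add: algebra_simps diff_mult_distrib2)
    finally show ?case .
  qed simp
  then have "card {P \<in> pg2_points. P \<subseteq> V} * (CARD('a) - 1)
      = (\<Sum>i<vec.dim V. CARD('a) ^ i) * (CARD('a) - 1)"
    using card_points_in_subspace[OF assms] card_subspace[OF assms] CARD_field_ge_2[where ?'a = 'a] by metis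
  then show ?thesis using CARD_field_ge_2[where ?'a = 'a] by simp
qed

lemma card_pg2_points:
  "card (pg2_points :: ('a::{field,finite} ^ 3) set set) = (CARD('a))\<^sup>2 + CARD('a) + 1"
  using card_points_of_dim[of "UNIV :: ('a ^ 3) set"]
  by (simp add: card_cart_basis numeral_3_eq_3 power2_eq_square)

lemma card_points_on_line:
  fixes L :: "('a::{field,finite} ^ 3) set"
  assumes "L \<in> pg2_lines"
  shows "card {P \<in> pg2_points. P \<subseteq> L} = CARD('a) + 1"
  using assms card_points_of_dim[of L] by (simp add: pg2_lines_def numeral_2_eq_2)

section \<open>The Frobenius map and the subfield of order \<open>s\<close>\<close>

lemma power_CARD_eq_self:
  fixes x :: "'a::{field,finite}"
  shows "x ^ CARD('a) = x"
proof (cases "x = 0")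
  case False
  \<comment> \<open>Multiplication by \<open>x\<close> permutes the nonzero elements, so their
    product can be cancelled.\<close>
  have "(\<Prod>y\<in>UNIV-{0}. x * y) = \<Prod>(UNIV - {0})"
    by (rule prod.reindex_bij_witness[of _ "\<lambda>y. y / x" "\<lambda>y. x * y"]) (use False in auto)
  then have "x ^ (CARD('a) - 1) * \<Prod>(UNIV - {0::'a}) = \<Prod>(UNIV - {0})"
    by (simp add: prod.distrib card_Diff_singleton)
  moreover have "\<Prod>(UNIV - {0::'a}) \<noteq> 0" by simp
  ultimately have "x ^ (CARD('a) - 1) = 1" by simp
  then show ?thesis
    by (metis mult.right_neutral power_eq_if zero_less_card_finite less_irrefl)
qed (simp add: power_0_left)

text \<open>These are the roots of a polynomial of degree \<open>s\<close>. The value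
  \<open>a = 1\<close> bounds the fixed field, and \<open>a = -1\<close> bounds the image of the
  Frobenius map minus the identity.\<close>

lemma card_power_eq_linear_le:
  fixes a :: "'a::field"
  assumes "s \<ge> 2"
  shows "card {x. x ^ s = a * x} \<le> s"
proof -
  let ?p = "monom 1 s - [:0, a:]"
  have deg: "degree ?p = s"
  proof -
    have "degree (- [:0, a:]) < degree (monom (1 :: 'a) s)" using assms by (simp add: degree_monom_eq)
    then show ?thesis
      using degree_add_eq_left[of "- [:0, a:]" "monom 1 s"]
      by (simp only: diff_conv_add_uminus) (simp add: degree_monom_eq)
  qed
  then have "?p \<noteq> 0" using assms by auto
  then have "card {x. poly ?p x = 0} \<le> s" using card_poly_roots_bound[of ?p] deg by simp
  moreover have "{x. poly ?p x = 0} = {x. x ^ s = a * x}" by (auto simp: poly_monom mult.commute)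
  ultimately show ?thesis by simp
qed

locale square_field =
  fixes s :: nat and ty :: "'a::{field,finite} itself"
  assumes CARD_eq: "CARD('a) = s\<^sup>2" and primepow_CARD: "primepow (CARD('a))"
begin

lemma s_ge_2: "s \<ge> 2"
proof (rule ccontr)
  assume "\<not> s \<ge> 2"
  then have "s = 0 \<or> s = 1" by auto
  then show False using CARD_eq CARD_field_ge_2[where ?'a = 'a] by auto
qed

text \<open>As a divisor of the prime power \<open>CARD('a)\<close>, \<open>s\<close> is a power of
  the characteristic. The characteristic is identified by summing all field elements before and
  after the shift by \<open>1\<close>.\<close>

lemma frobenius_add: "(x + y :: 'a) ^ s = x ^ s + y ^ s"
proof -
  have pr: "prime CHAR('a)"
    by (rule prime_CHAR_semidom, rule finite_imp_CHAR_pos) simp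
  obtain p k where p: "prime p" "CARD('a) = p ^ k"
    using primepow_CARD by (auto simp: primepow_def)
  have "(\<Sum>x\<in>UNIV. x + 1 :: 'a) = (\<Sum>x\<in>UNIV. x)"
    by (rule sum.reindex_bij_witness[of _ "\<lambda>x. x - 1" "\<lambda>x. x + 1"]) auto
  then have "of_nat (CARD('a)) = (0 :: 'a)" by (simp add: sum.distrib)
  then have "CHAR('a) dvd p ^ k" using of_nat_eq_0_iff_char_dvd p(2) by metis
  then have "CHAR('a) = p" using p(1) pr prime_dvd_power primes_dvd_imp_eq by blast
  moreover have "s dvd p ^ k" using p(2) CARD_eq by (metis dvd_triv_left power2_eq_square)
  then obtain i where "s = p ^ i" using p(1) divides_primepow_nat by blast
  ultimately show ?thesis using freshmans_dream'[OF pr] by metis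
qed

lemma frobenius_diff: "(x - y :: 'a) ^ s = x ^ s - y ^ s"
  using frobenius_add[of "x - y" y] by (simp add: algebra_simps)

lemma frobenius_frobenius: "((x :: 'a) ^ s) ^ s = x"
  using power_CARD_eq_self[of x] by (simp add: CARD_eq power2_eq_square flip: power_mult)

text \<open>The additive map sending \<open>x\<close> to \<open>x ^ s - x\<close> has the fixed
  field as kernel, and its image consists of solutions of \<open>y ^ s = - y\<close>. Both have at
  most \<open>s\<close> elements, but the product of their sizes is \<open>s * s\<close>.\<close>

lemma card_fixed_field: "card {x :: 'a. x ^ s = x} = s"
proof -
  let ?f = "\<lambda>x :: 'a. x ^ s - x"
  have "CARD('a) = card (range ?f) * card {x. ?f x = 0}"
    using card_additive_image[of "UNIV :: 'a set" ?f] by (simp add: frobenius_diff)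
  then have eq: "s * s = card (range ?f) * card {x :: 'a. x ^ s = x}"
    by (simp add: CARD_eq power2_eq_square)
  have "range ?f \<subseteq> {y. y ^ s = -1 * y}"
    by (auto simp: frobenius_diff frobenius_frobenius)
  then have r: "card (range ?f) \<le> s"
    using card_power_eq_linear_le[OF s_ge_2, of "-1 :: 'a"] by (meson card_mono finite order_trans)
  have k: "card {x :: 'a. x ^ s = x} \<le> s"
    using card_power_eq_linear_le[OF s_ge_2, of "1 :: 'a"] by simp
  show ?thesis
  proof (rule ccontr)
    assume "card {x :: 'a. x ^ s = x} \<noteq> s"
    then have "card {x :: 'a. x ^ s = x} < s" using k by simp
    then have "s * card {x :: 'a. x ^ s = x} < s * s" using s_ge_2 by simp
    moreover have "s * s \<le> s * card {x :: 'a. x ^ s = x}" unfolding eq using r by simp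
    ultimately show False by simp
  qed
qed

text \<open>
  On the fixed field, \<open>x\<^sup>3 - x\<close> takes the value \<open>0\<close> at both \<open>0\<close> and \<open>1\<close>, hence misses some \<open>c\<close>.
  A root of \<open>X\<^sup>3 - X - c\<close> outside the fixed field would have a conjugate root, and the third
  root would then be fixed.
\<close>

lemma ex_rootless_cubic: "\<exists>c :: 'a. c ^ s = c \<and> (\<forall>x. x ^ 3 \<noteq> x + c)"
proof -
  let ?F = "{x :: 'a. x ^ s = x}" and ?g = "\<lambda>x :: 'a. x ^ 3 - x"
  have sub: "?g ` ?F \<subseteq> ?F"
  proof clarify
    fix x :: 'a assume "x ^ s = x"
    moreover have "(x ^ 3) ^ s = (x ^ s) ^ 3" by (metis mult.commute power_mult)
    ultimately show "(x ^ 3 - x) ^ s = x ^ 3 - x" by (simp only: frobenius_diff)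
  qed
  have mem: "0 \<in> ?F" "1 \<in> ?F" using s_ge_2 by (auto simp: power_0_left)
  have "\<not> inj_on ?g ?F" using inj_onD[of ?g ?F 0 1] mem by auto
  then have "?g ` ?F \<noteq> ?F" using eq_card_imp_inj_on[of ?F ?g] by auto
  then obtain c where c: "c ^ s = c" "c \<notin> ?g ` ?F" using sub by blast
  have c_fixed: "x ^ 3 \<noteq> x + c" if "x ^ s = x" for x
  proof
    assume "x ^ 3 = x + c"
    then have "c = ?g x" by simp
    then show False using c(2) that by blast
  qed
  have "x ^ 3 \<noteq> x + c" for x
  proof
    assume x: "x ^ 3 = x + c"
    define y where "y = x ^ s"
    have y: "y ^ 3 = y + c"
      using arg_cong[OF x, of "\<lambda>z. z ^ s"] c(1) frobenius_add[of x c]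
      by (metis mult.commute power_mult y_def)
    have "x \<noteq> y" using c_fixed[of x] x by (auto simp: y_def)
    moreover have "(x - y) * (x\<^sup>2 + x * y + y\<^sup>2 - 1) = 0" using x y by algebra
    ultimately have e: "x\<^sup>2 + x * y + y\<^sup>2 = 1" by simp
    \<comment> \<open>The cubic has no quadratic term, so its roots sum to zero and this is the
      third one. Writing it with differences from \<open>0\<close> lets
      \<open>frobenius_diff\<close> treat odd and even \<open>s\<close> alike.\<close>
    have "(0 - x - y) ^ 3 = (0 - x - y) + c" using e x by algebra
    moreover have "(0 - x - y) ^ s = 0 - x - y"
      using s_ge_2 frobenius_frobenius[of x] by (simp only: frobenius_diff y_def) (simp add: power_0_left)
    ultimately show False using c_fixed by blast
  qed
  then show ?thesis using c(1) by blast
qed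

end

section \<open>The cubic extension as a multiplication on coordinate triples\<close>

text \<open>Multiplication of \<open>F[X]/(X\<^sup>3 - X - c)\<close> in the basis \<open>1, X, X\<^sup>2\<close>.\<close>

definition cubic_mult :: "'a::comm_ring_1 \<Rightarrow> 'a ^ 3 \<Rightarrow> 'a ^ 3 \<Rightarrow> 'a ^ 3" where
  "cubic_mult c x y = vector
     [x$1 * y$1 + c * (x$2 * y$3 + x$3 * y$2),
      x$1 * y$2 + x$2 * y$1 + (x$2 * y$3 + x$3 * y$2) + c * (x$3 * y$3),
      x$1 * y$3 + x$2 * y$2 + x$3 * y$1 + x$3 * y$3]"

lemma cubic_mult_nth [simp]:
  "cubic_mult c x y $ 1 = x$1 * y$1 + c * (x$2 * y$3 + x$3 * y$2)"
  "cubic_mult c x y $ 2 = x$1 * y$2 + x$2 * y$1 + (x$2 * y$3 + x$3 * y$2) + c * (x$3 * y$3)"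
  "cubic_mult c x y $ 3 = x$1 * y$3 + x$2 * y$2 + x$3 * y$1 + x$3 * y$3"
  by (simp_all add: cubic_mult_def)

lemma cubic_mult_add: "cubic_mult c u (x + y) = cubic_mult c u x + cubic_mult c u y"
  and cubic_mult_diff: "cubic_mult c u (x - y) = cubic_mult c u x - cubic_mult c u y"
  and cubic_mult_scale: "cubic_mult c u (a *s x) = a *s cubic_mult c u x"
  and cubic_mult_commute: "cubic_mult c x y = cubic_mult c y x"
  and cubic_mult_assoc: "cubic_mult c (cubic_mult c x y) z = cubic_mult c x (cubic_mult c y z)"
  and cubic_mult_one: "cubic_mult c x (vector [1, 0, 0]) = x"
  by (simp_all add: vec_eq_iff forall_3 algebra_simps)

lemma cubic_mult_zero [simp]: "cubic_mult c u 0 = 0"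
  using cubic_mult_diff[of c u 0 0] by simp

text \<open>A proper factorisation of a cubic has a linear factor, and hence a root.\<close>

lemma prime_elem_cubic:
  fixes c :: "'a::field"
  assumes rootless: "\<And>x. x ^ 3 \<noteq> x + c"
  shows "prime_elem [:-c, -1, 0, 1:]"
proof (rule field_poly_irreducible_imp_prime, rule irreducibleI)
  let ?f = "[:-c, -1, 0, 1:]"
  show "?f \<noteq> 0" "\<not> ?f dvd 1" by (simp_all add: is_unit_iff_degree)
  have no_linear: "degree g \<noteq> 1" if "?f = g * h" for g h
  proof
    assume "degree g = 1"
    then obtain a b where g: "g = [:b, a:]" "a \<noteq> 0" by (rule degree1_coeffs)
    have "poly ?f (- b / a) = 0" unfolding that g by (simp add: g(2))
    moreover have "poly ?f x = x ^ 3 - (x + c)" for x by (simp add: power3_eq_cube algebra_simps)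
    ultimately show False using rootless[of "- b / a"] by (metis right_minus_eq)
  qed
  fix g h assume gh: "?f = g * h"
  then have "g \<noteq> 0" "h \<noteq> 0" by auto
  then have "degree g + degree h = 3" using arg_cong[OF gh, of degree] by (simp add: degree_mult_eq)
  moreover have "degree g \<noteq> 1" "degree h \<noteq> 1"
    using no_linear[OF gh] no_linear[of h g] gh by (auto simp: mult.commute)
  ultimately have "degree g = 0 \<or> degree h = 0" by auto
  then show "g dvd 1 \<or> h dvd 1" using \<open>g \<noteq> 0\<close> \<open>h \<noteq> 0\<close> by (auto simp: is_unit_iff_degree)
qed

text \<open>Triples are read as polynomials of degree below 3, and \<open>cubic_mult\<close> is
  multiplication modulo the prime cubic. That cubic must divide one of the factors, whose degree is
  too small unless it vanishes.\<close>

lemma cubic_mult_eq_0_iff: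
  fixes c :: "'a::field"
  assumes rootless: "\<And>x. x ^ 3 \<noteq> x + c"
  shows "cubic_mult c x y = 0 \<longleftrightarrow> x = 0 \<or> y = 0"
proof
  let ?f = "[:-c, -1, 0, 1:]"
  define pol where "pol z = [:z$1, z$2, z$3:]" for z :: "'a ^ 3"
  have pol0: "z = 0" if "?f dvd pol z" for z
  proof -
    have "degree (pol z) < degree ?f" by (simp add: pol_def)
    then have "pol z = 0" using that by (meson dvd_imp_degree_le not_le)
    then show ?thesis by (simp add: pol_def vec_eq_iff forall_3)
  qed
  \<comment> \<open>The quotient of the division by the monic cubic consists of the coefficients of
    degree 3 and 4 of the product.\<close>
  have eq: "pol x * pol y = pol (cubic_mult c x y) + ?f * [:x$2 * y$3 + x$3 * y$2, x$3 * y$3:]"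
    by (simp add: pol_def algebra_simps)
  assume "cubic_mult c x y = 0"
  moreover have "pol 0 = 0" by (simp add: pol_def)
  ultimately have "?f dvd pol x * pol y" unfolding eq by (simp only: add_0 dvd_triv_left)
  then show "x = 0 \<or> y = 0"
    using prime_elem_dvd_mult_iff[OF prime_elem_cubic[OF rootless]] pol0 by blast
qed (auto simp: cubic_mult_commute[of c 0])

text \<open>Since \<open>c\<close> lies in the subfield and the cubic has no root even in the large
  field, one multiplication makes all triples a field and the triples over the subfield a subfield
  of it.\<close>

locale cubic_extension = square_field s ty for s and ty :: "'a::{field,finite} itself" +
  fixes c :: 'a
  assumes c_fixed: "c ^ s = c" and rootless: "x ^ 3 \<noteq> x + c"
begin

abbreviation mult :: "'a ^ 3 \<Rightarrow> 'a ^ 3 \<Rightarrow> 'a ^ 3" (infixl "\<star>" 70) where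
  "x \<star> y \<equiv> cubic_mult c x y"

lemmas mult_eq_0_iff [simp] = cubic_mult_eq_0_iff[OF rootless]

lemma mult_left_cancel: "u \<noteq> 0 \<Longrightarrow> u \<star> x = u \<star> y \<longleftrightarrow> x = y"
  using mult_eq_0_iff[of u "x - y"] by (auto simp: cubic_mult_diff)

section \<open>Linear algebra over the subfield of order \<open>s\<close>\<close>

definition F\<^sub>0 :: "'a set" where "F\<^sub>0 = {x. x ^ s = x}"

lemma F0_closed:
  "0 \<in> F\<^sub>0" "1 \<in> F\<^sub>0" "c \<in> F\<^sub>0"
  "x \<in> F\<^sub>0 \<Longrightarrow> y \<in> F\<^sub>0 \<Longrightarrow> x + y \<in> F\<^sub>0"
  "x \<in> F\<^sub>0 \<Longrightarrow> y \<in> F\<^sub>0 \<Longrightarrow> x - y \<in> F\<^sub>0"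
  "x \<in> F\<^sub>0 \<Longrightarrow> y \<in> F\<^sub>0 \<Longrightarrow> x * y \<in> F\<^sub>0"
  "x \<in> F\<^sub>0 \<Longrightarrow> inverse x \<in> F\<^sub>0"
  using s_ge_2 c_fixed
  by (simp_all add: F\<^sub>0_def frobenius_add frobenius_diff power_mult_distrib power_inverse power_0_left)

lemma card_F0: "card F\<^sub>0 = s"
  unfolding F\<^sub>0_def by (rule card_fixed_field)

definition F0_subspace :: "('a ^ 3) set \<Rightarrow> bool" where
  "F0_subspace S \<longleftrightarrow> 0 \<in> S \<and> (\<forall>x\<in>S. \<forall>y\<in>S. x + y \<in> S) \<and> (\<forall>a\<in>F\<^sub>0. \<forall>x\<in>S. a *s x \<in> S)"

lemma F0_subspaceD:
  assumes "F0_subspace S"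
  shows "0 \<in> S" "x \<in> S \<Longrightarrow> y \<in> S \<Longrightarrow> x + y \<in> S" "a \<in> F\<^sub>0 \<Longrightarrow> x \<in> S \<Longrightarrow> a *s x \<in> S"
    "x \<in> S \<Longrightarrow> y \<in> S \<Longrightarrow> x - y \<in> S"
proof -
  show add: "x \<in> S \<Longrightarrow> y \<in> S \<Longrightarrow> x + y \<in> S" for x y using assms by (auto simp: F0_subspace_def)
  show "0 \<in> S" and scale: "\<And>x a. a \<in> F\<^sub>0 \<Longrightarrow> x \<in> S \<Longrightarrow> a *s x \<in> S"
    using assms by (auto simp: F0_subspace_def)
  have "(0 - 1) *s y \<in> S" if "y \<in> S" for y using that by (intro scale F0_closed)
  then have "- y \<in> S" if "y \<in> S" for y using that by simp
  then show "x - y \<in> S" if "x \<in> S" "y \<in> S" using that add[of x "- y"] by simp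
qed

text \<open>The extension step for \<open>card_F0_subspace\<close>: as \<open>w\<close> is outside
  \<open>T\<close>, each element of \<open>T'\<close> determines its scalar and its component in
  \<open>T\<close>.\<close>

lemma F0_subspace_extend:
  assumes T: "F0_subspace T" and w: "w \<notin> T"
  defines "T' \<equiv> (\<lambda>(a, t). a *s w + t) ` (F\<^sub>0 \<times> T)"
  shows "F0_subspace T'" and "card T' = s * card T" and "T \<subseteq> T'"
proof -
  note Tc = F0_subspaceD[OF T]
  have mem: "a *s w + t \<in> T'" if "a \<in> F\<^sub>0" "t \<in> T" for a t using that by (auto simp: T'_def)
  show "T \<subseteq> T'" using mem[of 0] F0_closed(1) by auto
  show "F0_subspace T'"
    unfolding F0_subspace_def
  proof (intro conjI ballI)
    show "0 \<in> T'" using mem[of 0 0] F0_closed(1) Tc(1) by simp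
  next
    fix x y assume "x \<in> T'" "y \<in> T'"
    then obtain a t b r where h: "a \<in> F\<^sub>0" "t \<in> T" "x = a *s w + t" "b \<in> F\<^sub>0" "r \<in> T" "y = b *s w + r"
      by (auto simp: T'_def)
    then have "x + y = (a + b) *s w + (t + r)" by (simp add: vec.scale_left_distrib)
    then show "x + y \<in> T'" using h mem F0_closed(4) Tc(2) by metis
  next
    fix b x assume "b \<in> F\<^sub>0" "x \<in> T'"
    then obtain a t where h: "b \<in> F\<^sub>0" "a \<in> F\<^sub>0" "t \<in> T" "x = a *s w + t" by (auto simp: T'_def)
    then have "b *s x = (b * a) *s w + b *s t" by (simp add: vec.scale_right_distrib)
    then show "b *s x \<in> T'" using h mem F0_closed(6) Tc(3) by metis
  qed
  have "inj_on (\<lambda>(a, t). a *s w + t) (F\<^sub>0 \<times> T)"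
  proof (rule inj_onI, clarsimp)
    fix a t b r assume h: "a \<in> F\<^sub>0" "t \<in> T" "b \<in> F\<^sub>0" "r \<in> T" and eq: "a *s w + t = b *s w + r"
    have eq': "(a - b) *s w = r - t" using eq by (simp add: algebra_simps)
    have "a = b"
    proof (rule ccontr)
      assume "a \<noteq> b"
      then have "w = inverse (a - b) *s ((a - b) *s w)"
        by (simp only: vec.scale_scale left_inverse right_minus_eq vec.scale_one not_False_eq_True)
      also have "\<dots> \<in> T" unfolding eq' using h by (intro Tc F0_closed)
      finally show False using w by simp
    qed
    then show "a = b \<and> t = r" using eq by simp
  qed
  then show "card T' = s * card T"
    by (simp add: T'_def card_image card_cartesian_product card_F0)
qed

text \<open>The subfield \<open>F\<^sub>0\<close> is not a type, so the dimension theory of \<open>vec\<close> does not apply over it.\<close>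

lemma card_F0_subspace:
  assumes S: "F0_subspace S"
  shows "\<exists>d. card S = s ^ d"
proof -
  \<comment> \<open>A subspace \<open>T\<close> of \<open>S\<close>, initially \<open>{0}\<close>,
    is enlarged one vector at a time until it equals \<open>S\<close>.\<close>
  have "\<exists>d. card S = s ^ d" if "F0_subspace T" "T \<subseteq> S" "\<exists>d. card T = s ^ d" for T
    using that
  proof (induction "card S - card T" arbitrary: T rule: less_induct)
    case less
    show ?case
    proof (cases "T = S")
      case False
      then obtain w where w: "w \<in> S" "w \<notin> T" using less.prems by blast
      define T' where "T' = (\<lambda>(a, t). a *s w + t) ` (F\<^sub>0 \<times> T)"
      note ext = F0_subspace_extend[OF less.prems(1) w(2), folded T'_def]
      obtain d where d: "card T = s ^ d" using less.prems by blast
      have T'S: "T' \<subseteq> S"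
        unfolding T'_def using w less.prems(2) F0_subspaceD[OF S] by auto
      have "card T' = s ^ Suc d" using ext d by simp
      moreover have "card T < card T'"
        using ext(2) d s_ge_2 by simp
      moreover have "card T' \<le> card S" by (rule card_mono) (use T'S in auto)
      ultimately show ?thesis using less.hyps[of T'] ext(1) T'S by (metis diff_less_mono2 order_less_le_trans)
    qed (use less.prems in auto)
  qed
  moreover have "F0_subspace {0}" by (auto simp: F0_subspace_def)
  moreover have "\<exists>d. card {0 :: 'a ^ 3} = s ^ d" by (intro exI[of _ 0]) simp
  ultimately show ?thesis using F0_subspaceD(1)[OF S] by (metis empty_subsetI insert_subset)
qed

definition K\<^sub>0 :: "('a ^ 3) set" where "K\<^sub>0 = {x. \<forall>i. x $ i \<in> F\<^sub>0}"

lemma F0_subspace_K0: "F0_subspace K\<^sub>0"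
  by (auto simp: F0_subspace_def K\<^sub>0_def F0_closed)

lemma card_K0: "card K\<^sub>0 = s ^ 3"
proof -
  have "K\<^sub>0 = (\<lambda>(x, y, z). vector [x, y, z]) ` (F\<^sub>0 \<times> F\<^sub>0 \<times> F\<^sub>0)"
  proof (intro equalityI subsetI)
    fix v assume "v \<in> K\<^sub>0"
    then show "v \<in> (\<lambda>(x, y, z). vector [x, y, z]) ` (F\<^sub>0 \<times> F\<^sub>0 \<times> F\<^sub>0)"
      by (intro image_eqI[of _ _ "(v $ 1, v $ 2, v $ 3)"]) (auto simp: K\<^sub>0_def vec_eq_iff forall_3)
  qed (auto simp: K\<^sub>0_def forall_3)
  moreover have "inj_on (\<lambda>(x, y, z). vector [x, y, z] :: 'a ^ 3) (F\<^sub>0 \<times> F\<^sub>0 \<times> F\<^sub>0)"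
    by (auto simp: inj_on_def vec_eq_iff forall_3)
  ultimately show ?thesis
    by (simp add: card_image card_cartesian_product card_F0 power3_eq_cube)
qed

lemma K0_mult: "x \<in> K\<^sub>0 \<Longrightarrow> y \<in> K\<^sub>0 \<Longrightarrow> x \<star> y \<in> K\<^sub>0"
  by (simp add: K\<^sub>0_def forall_3 F0_closed)

text \<open>Multiplication by \<open>k\<close> is injective on the finite set
  \<open>K\<^sub>0\<close>, hence onto; this gives division without constructing inverses.\<close>

lemma K0_divide:
  assumes k: "k \<in> K\<^sub>0" "k \<noteq> 0" and k': "k' \<in> K\<^sub>0"
  obtains m where "m \<in> K\<^sub>0" "k' = k \<star> m"
proof -
  have "(\<star>) k ` K\<^sub>0 = K\<^sub>0"
    by (rule endo_inj_surj) (use k K0_mult mult_left_cancel in \<open>auto simp: inj_on_def\<close>)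
  then show ?thesis using that k' by blast
qed

text \<open>Comparing a nonzero coordinate suffices. Thus a projective point with a representative
  in \<open>K\<^sub>0\<close> has exactly \<open>s - 1\<close> of them there.\<close>

lemma scale_mem_K0:
  assumes "k \<in> K\<^sub>0" "k \<noteq> 0" "a *s k \<in> K\<^sub>0"
  shows "a \<in> F\<^sub>0"
proof -
  obtain i where i: "k $ i \<noteq> 0" using assms(2) by (auto simp: vec_eq_iff)
  have "a * k $ i \<in> F\<^sub>0" "k $ i \<in> F\<^sub>0" using assms by (auto simp: K\<^sub>0_def)
  then have "(a * k $ i) * inverse (k $ i) \<in> F\<^sub>0" by (rule F0_closed(6)[OF _ F0_closed(7)])
  moreover have "(a * k $ i) * inverse (k $ i) = a" using i by (simp add: mult.assoc)
  ultimately show ?thesis by simp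
qed

text \<open>The fibres are the orbits under nonzero subfield scalars. Taking
  \<open>S = K\<^sub>0\<close> counts a whole Baer subplane; a smaller \<open>S\<close> counts its
  intersection with a line.\<close>

lemma card_span_image:
  assumes S: "F0_subspace S" "S \<subseteq> K\<^sub>0" and u: "u \<noteq> 0"
  shows "card S - 1 = card ((\<lambda>k. vec.span {u \<star> k}) ` (S - {0})) * (s - 1)"
proof -
  have "card (S - {0}) = card ((\<lambda>k. vec.span {u \<star> k}) ` (S - {0})) * (s - 1)"
  proof (rule card_eq_card_image_times_fibre)
    fix k assume k: "k \<in> S - {0}"
    have iff: "vec.span {u \<star> j} = vec.span {u \<star> k} \<longleftrightarrow> (\<exists>a. a \<noteq> 0 \<and> j = a *s k)" if "j \<noteq> 0" for j
      using that u span_singleton_eq_iff[of "u \<star> j" "u \<star> k"]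
      by (simp add: mult_left_cancel flip: cubic_mult_scale)
    have "{j \<in> S - {0}. vec.span {u \<star> j} = vec.span {u \<star> k}} = (\<lambda>a. a *s k) ` (F\<^sub>0 - {0})"
    proof (intro equalityI subsetI)
      fix j assume j: "j \<in> {j \<in> S - {0}. vec.span {u \<star> j} = vec.span {u \<star> k}}"
      then obtain a where a: "a \<noteq> 0" "j = a *s k" using iff[of j] by auto
      moreover have "a \<in> F\<^sub>0" by (rule scale_mem_K0[of k]) (use a j k S(2) in auto)
      ultimately show "j \<in> (\<lambda>a. a *s k) ` (F\<^sub>0 - {0})" by blast
    next
      fix j assume "j \<in> (\<lambda>a. a *s k) ` (F\<^sub>0 - {0})"
      then obtain a where a: "a \<in> F\<^sub>0" "a \<noteq> 0" "j = a *s k" by blast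
      then have "j \<noteq> 0" "j \<in> S" using k F0_subspaceD(3)[OF S(1)] by auto
      then show "j \<in> {j \<in> S - {0}. vec.span {u \<star> j} = vec.span {u \<star> k}}" using iff[of j] a by auto
    qed
    moreover have "inj_on (\<lambda>a. a *s k) (F\<^sub>0 - {0})" using k by (auto simp: inj_on_def)
    ultimately show "card {j \<in> S - {0}. vec.span {u \<star> j} = vec.span {u \<star> k}} = s - 1"
      using F0_closed(1) by (simp add: card_image card_Diff_singleton card_F0)
  qed simp
  then show ?thesis using F0_subspaceD(1)[OF S(1)] by (simp add: card_Diff_singleton)
qed

section \<open>Baer subplanes and sets with two line intersection numbers\<close>

text \<open>
  Multiplication by \<open>u\<close> is a collineation, so \<open>baer u\<close> is a copy of the canonical Baer subplane
  \<open>PG(2,s)\<close>. Two copies agree or are disjoint because \<open>K\<^sub>0\<close> is a subfield.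
\<close>

definition baer :: "'a ^ 3 \<Rightarrow> ('a ^ 3) set set" where
  "baer u = (\<lambda>k. vec.span {u \<star> k}) ` (K\<^sub>0 - {0})"

lemma baer_subset_points: "u \<noteq> 0 \<Longrightarrow> baer u \<subseteq> pg2_points"
  by (auto simp: baer_def intro!: span_singleton_in_points)

lemma card_baer: "u \<noteq> 0 \<Longrightarrow> card (baer u) = s\<^sup>2 + s + 1"
proof -
  assume "u \<noteq> 0"
  then have "card (baer u) * (s - 1) = s ^ 3 - 1"
    using card_span_image[OF F0_subspace_K0 order_refl] by (simp add: baer_def card_K0)
  also have "\<dots> = (s\<^sup>2 + s + 1) * (s - 1)"
    using s_ge_2 by (simp add: power2_eq_square power3_eq_cube algebra_simps diff_mult_distrib2)
  finally show ?thesis using s_ge_2 by (metis mult_cancel2 One_nat_def Suc_1 diff_is_0_eq not_less_eq_eq)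
qed

lemma span_mem_baer: "u \<noteq> 0 \<Longrightarrow> vec.span {u} \<in> baer u"
  unfolding baer_def
  by (rule image_eqI[of _ _ "vector [1, 0, 0]"])
    (auto simp: cubic_mult_one K\<^sub>0_def forall_3 F0_closed vec_eq_iff)

text \<open>A common point means that \<open>u \<star> k\<close> is a multiple of
  \<open>v \<star> j\<close>. Any \<open>i\<close> in \<open>K\<^sub>0\<close> equals
  \<open>k \<star> m\<close>, so \<open>u \<star> i\<close> is the same multiple of
  \<open>v \<star> (j \<star> m)\<close>.\<close>

lemma baer_subset_if_common_point:
  assumes u: "u \<noteq> 0" and v: "v \<noteq> 0" and common: "P \<in> baer u" "P \<in> baer v"
  shows "baer u \<subseteq> baer v"
proof
  obtain k j where k: "k \<in> K\<^sub>0" "k \<noteq> 0" "P = vec.span {u \<star> k}"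
    and j: "j \<in> K\<^sub>0" "j \<noteq> 0" "P = vec.span {v \<star> j}"
    using common by (auto simp: baer_def)
  then obtain a where a: "a \<noteq> 0" "u \<star> k = a *s (v \<star> j)"
    using span_singleton_eq_iff[of "u \<star> k" "v \<star> j"] u by auto
  fix Q assume "Q \<in> baer u"
  then obtain i where i: "i \<in> K\<^sub>0" "i \<noteq> 0" "Q = vec.span {u \<star> i}" by (auto simp: baer_def)
  obtain m where m: "m \<in> K\<^sub>0" "i = k \<star> m" using K0_divide k(1,2) i(1) by blast
  have "u \<star> i = (u \<star> k) \<star> m" by (simp add: m cubic_mult_assoc)
  also have "\<dots> = a *s (v \<star> (j \<star> m))"
    unfolding a by (metis cubic_mult_assoc cubic_mult_commute cubic_mult_scale)
  finally have "vec.span {u \<star> i} = vec.span {v \<star> (j \<star> m)}"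
    using span_singleton_eq_iff[of "u \<star> i" "v \<star> (j \<star> m)"] i(2) u a(1) mult_eq_0_iff[of u i] by blast
  then have "Q = vec.span {v \<star> (j \<star> m)}" using i(3) by simp
  moreover have "j \<star> m \<noteq> 0" using i(2) j(2) m(2) by auto
  ultimately show "Q \<in> baer v" using K0_mult[OF j(1) m(1)] by (auto simp: baer_def)
qed

text \<open>The preimage \<open>S\<close> of the line in \<open>K\<^sub>0\<close> is a subspace over
  the subfield. It is proper, and a dimension count makes it nonzero, so it has \<open>s\<close> or
  \<open>s^2\<close> elements and yields 1 or \<open>s + 1\<close> points.\<close>

lemma card_baer_inter_line:
  assumes u: "u \<noteq> 0" and L: "L \<in> pg2_lines"
  shows "card {P \<in> baer u. P \<subseteq> L} = 1 \<or> card {P \<in> baer u. P \<subseteq> L} = s + 1"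
proof -
  have sL: "vec.subspace L" and dL: "vec.dim L = 2" using L by (auto simp: pg2_lines_def)
  define S where "S = {k \<in> K\<^sub>0. u \<star> k \<in> L}"
  have SK: "S \<subseteq> K\<^sub>0" by (auto simp: S_def)
  have S: "F0_subspace S"
    using F0_subspaceD[OF F0_subspace_K0] vec.subspace_0[OF sL] vec.subspace_add[OF sL] vec.subspace_scale[OF sL]
    by (simp add: F0_subspace_def S_def cubic_mult_add cubic_mult_scale)
  have "{P \<in> baer u. P \<subseteq> L} = (\<lambda>k. vec.span {u \<star> k}) ` (S - {0})"
    unfolding baer_def S_def using span_singleton_subset_iff[OF sL] by blast
  then have cS: "card S - 1 = card {P \<in> baer u. P \<subseteq> L} * (s - 1)"
    using card_span_image[OF S SK u] by simp
  have "S \<noteq> K\<^sub>0"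
  \<comment> \<open>\<open>K\<^sub>0\<close> contains the standard basis, and multiplication by
    \<open>u\<close> is onto, so \<open>S = K\<^sub>0\<close> would make the line the whole
    space.\<close>
  proof
    assume "S = K\<^sub>0"
    then have uK: "u \<star> k \<in> L" if "k \<in> K\<^sub>0" for k using that by (auto simp: S_def)
    have "y \<in> L" for y
    proof -
      have "surj ((\<star>) u)" by (rule finite_UNIV_inj_surj) (use u mult_left_cancel in \<open>auto simp: inj_on_def\<close>)
      then obtain x where x: "y = u \<star> x" by blast
      have "u \<star> x = u \<star> (x$1 *s vector [1, 0, 0] + x$2 *s vector [0, 1, 0] + x$3 *s vector [0, 0, 1])"
        by (rule arg_cong[where f = "(\<star>) u"]) (simp add: vec_eq_iff forall_3)
      then have "y = x$1 *s (u \<star> vector [1, 0, 0]) + x$2 *s (u \<star> vector [0, 1, 0]) + x$3 *s (u \<star> vector [0, 0, 1])"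
        by (simp only: x cubic_mult_add cubic_mult_scale)
      also have "\<dots> \<in> L"
        by (intro vec.subspace_add[OF sL] vec.subspace_scale[OF sL] uK)
          (simp_all add: K\<^sub>0_def forall_3 F0_closed)
      finally show ?thesis .
    qed
    then have "L = UNIV" by blast
    then show False using dL by (simp add: card_cart_basis)
  qed
  then have "card S < s ^ 3" using SK psubset_card_mono[of K\<^sub>0 S] card_K0 by auto
  moreover have "s \<le> card S"
  proof -
    \<comment> \<open>Its kernel is a copy of \<open>S\<close>. Over the subfield the domain has
      dimension 3 + 4 and the codomain 6, so the kernel has dimension at least 1.\<close>
    let ?f = "\<lambda>(k, l). u \<star> k - l"
    have ker: "{x \<in> K\<^sub>0 \<times> L. ?f x = 0} = (\<lambda>k. (k, u \<star> k)) ` S" by (auto simp: S_def)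
    have "s ^ 6 * s = card (K\<^sub>0 \<times> L)"
      by (simp add: card_cartesian_product card_K0 card_subspace[OF sL] dL CARD_eq) (simp add: eval_nat_numeral)
    also have "\<dots> = card (?f ` (K\<^sub>0 \<times> L)) * card {x \<in> K\<^sub>0 \<times> L. ?f x = 0}"
      by (rule card_additive_image)
        (auto simp: cubic_mult_diff F0_subspaceD(4)[OF F0_subspace_K0] vec.subspace_diff[OF sL])
    also have "card {x \<in> K\<^sub>0 \<times> L. ?f x = 0} = card S"
      unfolding ker by (rule card_image) (auto simp: inj_on_def)
    also have "card (?f ` (K\<^sub>0 \<times> L)) * card S \<le> CARD('a ^ 3) * card S"
      by (intro mult_le_mono1 card_mono) auto
    also have "CARD('a ^ 3) = s ^ 6" by (simp add: CARD_eq)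
    finally have "s ^ 6 * s \<le> s ^ 6 * card S" .
    then show ?thesis using s_ge_2 by simp
  qed
  moreover obtain d where d: "card S = s ^ d" using card_F0_subspace[OF S] by blast
  ultimately have "1 \<le> d" "d < 3"
    using s_ge_2 power_strict_increasing_iff[of s d 3] power_increasing_iff[of s 1 d] by auto
  then have "d = 1 \<or> d = 2" by auto
  then show ?thesis
  proof
    assume "d = 1"
    then have "1 * (s - 1) = card {P \<in> baer u. P \<subseteq> L} * (s - 1)" using cS d by simp
    then show ?thesis using s_ge_2 by (simp only: mult_cancel2) auto
  next
    assume "d = 2"
    then have "(s + 1) * (s - 1) = card {P \<in> baer u. P \<subseteq> L} * (s - 1)"
      using cS d s_ge_2 by (simp add: power2_eq_square algebra_simps diff_mult_distrib2)
    then show ?thesis using s_ge_2 by (simp only: mult_cancel2) auto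
  qed
qed

definition subplanes :: "('a ^ 3) set set set" where "subplanes = baer ` {u. u \<noteq> 0}"

lemma finite_subplanes: "finite subplanes"
  by (simp add: subplanes_def)

lemma subplanes_disjoint: "B \<in> subplanes \<Longrightarrow> B' \<in> subplanes \<Longrightarrow> B \<noteq> B' \<Longrightarrow> B \<inter> B' = {}"
  unfolding subplanes_def using baer_subset_if_common_point by fastforce

lemma Union_subplanes: "\<Union>subplanes = pg2_points"
proof
  show "\<Union>subplanes \<subseteq> pg2_points" using baer_subset_points by (auto simp: subplanes_def)
  show "pg2_points \<subseteq> \<Union>subplanes"
    using span_mem_baer by (auto simp: subplanes_def elim!: points_spanE)
qed

lemma card_Union_subplanes:
  assumes "\<S> \<subseteq> subplanes"
  shows "card (\<Union>\<S>) = card \<S> * (s\<^sup>2 + s + 1)"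
proof -
  have "card (\<Union>\<S>) = (\<Sum>B\<in>\<S>. card B)"
    by (rule card_Union_disjoint)
      (use assms subplanes_disjoint in \<open>auto simp: pairwise_def disjnt_def subset_iff\<close>)
  also have "\<dots> = (\<Sum>B\<in>\<S>. s\<^sup>2 + s + 1)"
    using assms card_baer by (intro sum.cong) (auto simp: subplanes_def)
  finally show ?thesis by simp
qed

text \<open>The subplanes partition the points, and
  \<open>s^4 + s^2 + 1 = (s^2 - s + 1) (s^2 + s + 1)\<close>. The additive form avoids truncated
  subtraction.\<close>

lemma card_subplanes: "card subplanes + s = s\<^sup>2 + 1"
proof -
  have "int (card subplanes) * (int s ^ 2 + int s + 1) = (int s ^ 2)\<^sup>2 + int s ^ 2 + 1"
    using arg_cong[OF card_Union_subplanes[OF order_refl], of int] card_pg2_points[where ?'a = 'a]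
    by (simp add: Union_subplanes CARD_eq algebra_simps)
  also have "\<dots> = (int s ^ 2 - int s + 1) * (int s ^ 2 + int s + 1)"
    by (simp add: power2_eq_square algebra_simps)
  finally have "int (card subplanes) = int s ^ 2 - int s + 1"
    using s_ge_2 by (subst (asm) mult_cancel_right) (auto simp: add_nonneg_eq_0_iff)
  then have "int (card subplanes + s) = int (s\<^sup>2 + 1)" by simp
  then show ?thesis by (simp only: of_nat_eq_iff)
qed

lemma card_Union_subplanes_inter_line:
  assumes \<S>: "\<S> \<subseteq> subplanes" and L: "L \<in> pg2_lines"
  shows "card {P \<in> \<Union>\<S>. P \<subseteq> L} = card \<S> + s * card {B \<in> \<S>. card {P \<in> B. P \<subseteq> L} = s + 1}"
proof -
  have fin: "finite \<S>" using \<S> finite_subplanes finite_subset by blast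
  have "{P \<in> \<Union>\<S>. P \<subseteq> L} = (\<Union>B\<in>\<S>. {P \<in> B. P \<subseteq> L})" by blast
  also have "card \<dots> = (\<Sum>B\<in>\<S>. card {P \<in> B. P \<subseteq> L})"
  proof (rule card_UN_disjoint[OF fin], simp, intro ballI impI)
    fix B B' assume "B \<in> \<S>" "B' \<in> \<S>" "B \<noteq> B'"
    then show "{P \<in> B. P \<subseteq> L} \<inter> {P \<in> B'. P \<subseteq> L} = {}" using \<S> subplanes_disjoint by blast
  qed
  also have "\<dots> = (\<Sum>B\<in>\<S>. 1 + (if card {P \<in> B. P \<subseteq> L} = s + 1 then s else 0))"
  proof (rule sum.cong)
    fix B assume "B \<in> \<S>"
    then have "card {P \<in> B. P \<subseteq> L} = 1 \<or> card {P \<in> B. P \<subseteq> L} = s + 1"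
      using \<S> card_baer_inter_line[OF _ L] by (auto simp: subplanes_def)
    then show "card {P \<in> B. P \<subseteq> L} = 1 + (if card {P \<in> B. P \<subseteq> L} = s + 1 then s else 0)"
      using s_ge_2 by auto
  qed simp
  also have "\<dots> = card \<S> + s * card {B \<in> \<S>. card {P \<in> B. P \<subseteq> L} = s + 1}"
    using fin by (simp only: sum.distrib sum.inter_filter[symmetric]) simp
  finally show ?thesis .
qed

lemma ex_two_intersection_set:
  assumes "k + s \<le> s\<^sup>2 + 1"
  shows "\<exists>X \<subseteq> (pg2_points :: ('a ^ 3) set set). card X = k * (s\<^sup>2 + s + 1) \<and>
    (\<forall>L\<in>pg2_lines. card {P \<in> X. P \<subseteq> L} = k \<or> card {P \<in> X. P \<subseteq> L} = k + s)"
proof -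
  have "k \<le> card subplanes" using assms card_subplanes by simp
  then obtain \<S> where \<S>: "\<S> \<subseteq> subplanes" "card \<S> = k" by (meson obtain_subset_with_card_n)
  have "card {P \<in> \<Union>\<S>. P \<subseteq> L} = k \<or> card {P \<in> \<Union>\<S>. P \<subseteq> L} = k + s" if L: "L \<in> pg2_lines" for L
  proof -
    let ?sec = "\<lambda>\<T>. {B \<in> \<T>. card {P \<in> B. P \<subseteq> L} = s + 1}"
    \<comment> \<open>For the family of all subplanes the count is the full size of the line. This
      forces exactly one secant subplane, so a subfamily contains at most one.\<close>
    have "s\<^sup>2 + 1 = card subplanes + s * card (?sec subplanes)"
      using card_Union_subplanes_inter_line[OF order_refl L] card_points_on_line[OF L]
      by (simp add: Union_subplanes CARD_eq)
    then have "s = s * card (?sec subplanes)" using card_subplanes by linarith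
    moreover have "n = 1" if "s = s * n" for n using that s_ge_2 by simp
    ultimately have "card (?sec subplanes) = 1" by blast
    moreover have "card (?sec \<S>) \<le> card (?sec subplanes)"
      by (rule card_mono) (use \<S> finite_subplanes in auto)
    ultimately have "card (?sec \<S>) = 0 \<or> card (?sec \<S>) = 1" by linarith
    then show ?thesis using card_Union_subplanes_inter_line[OF \<S>(1) L] \<S>(2) by auto
  qed
  moreover have "\<Union>\<S> \<subseteq> pg2_points" using \<S>(1) Union_subplanes by blast
  moreover have "card (\<Union>\<S>) = k * (s\<^sup>2 + s + 1)" using card_Union_subplanes[OF \<S>(1)] \<S>(2) by simp
  ultimately show ?thesis by (intro exI[of _ "\<Union>\<S>"]) simp
qed

end

text \<open>Summing the intersections with \<open>X\<close> over the pencil of \<open>p\<close> in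
  two ways determines how many of its lines are long. The prescribed size of \<open>X\<close> makes
  the dual numbers again \<open>k\<close> and \<open>k + s\<close>.\<close>

lemma (in finite_projective_plane) degree_from_two_intersection_set:
  assumes X: "X \<subseteq> Pts" and cX: "card X = k * (q + s + 1)" and s: "s > 0" "q = s\<^sup>2"
    and two: "\<And>l. l \<in> Lns \<Longrightarrow> card {p \<in> X. I p l} = k \<or> card {p \<in> X. I p l} = k + s"
    and p: "p \<in> Pts"
  shows "card {l \<in> {l \<in> Lns. card {p \<in> X. I p l} = k + s}. I p l} = k + (if p \<in> X then s else 0)"
proof -
  let ?Y = "{l \<in> Lns. card {p \<in> X. I p l} = k + s}"
  have fin: "finite {l \<in> Lns. I p l}" using finite_Lns by simp
  have "card X + (if p \<in> X then q else 0) = (\<Sum>l\<in>{l \<in> Lns. I p l}. card {p' \<in> X. I p' l})"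
    using sum_lines_through[OF X p] by simp
  also have "\<dots> = (\<Sum>l\<in>{l \<in> Lns. I p l}. k + (if l \<in> ?Y then s else 0))"
    using two s(1) by (intro sum.cong) auto
  also have "\<dots> = k * (q + 1) + s * card {l \<in> {l \<in> Lns. I p l}. l \<in> ?Y}"
    using fin card_lines_through[OF p]
    by (simp only: sum.distrib sum.inter_filter[symmetric]) simp
  also have "{l \<in> {l \<in> Lns. I p l}. l \<in> ?Y} = {l \<in> ?Y. I p l}" by auto
  finally have "k * s + (if p \<in> X then s * s else 0) = s * card {l \<in> ?Y. I p l}"
    unfolding cX by (auto simp: s(2) algebra_simps power2_eq_square split: if_splits)
  then have "s * (k + (if p \<in> X then s else 0)) = s * card {l \<in> ?Y. I p l}"
    by (auto simp: algebra_simps split: if_splits)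
  moreover have "m = n" if "s * m = s * n" for m n using that s(1) by simp
  ultimately show ?thesis by (intro sym[of _ "card _"]) blast
qed

section \<open>Degrees in the incidence graph\<close>

lemma degree_in_point:
  assumes P: "P \<in> pg2_points" and A: "A \<subseteq> vertices pg2_incidence_graph"
  shows "degree_in pg2_incidence_graph A (Inl P) = card {L \<in> Inr -` A. P \<subseteq> L}"
proof -
  have "{w \<in> A. {Inl P, w} \<in> edges pg2_incidence_graph} = Inr ` {L \<in> Inr -` A. P \<subseteq> L}"
    using P A by (auto simp: pg2_incidence_graph_def doubleton_eq_iff)
  then show ?thesis unfolding degree_in_def by (simp add: card_image)
qed

lemma degree_in_line:
  assumes L: "L \<in> pg2_lines" and A: "A \<subseteq> vertices pg2_incidence_graph"
  shows "degree_in pg2_incidence_graph A (Inr L) = card {P \<in> Inl -` A. P \<subseteq> L}"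
proof -
  have "{w \<in> A. {Inr L, w} \<in> edges pg2_incidence_graph} = Inl ` {P \<in> Inl -` A. P \<subseteq> L}"
    using L A by (auto simp: pg2_incidence_graph_def doubleton_eq_iff)
  then show ?thesis unfolding degree_in_def by (simp add: card_image)
qed

lemma vertices_pg2: "vertices pg2_incidence_graph = pg2_points <+> pg2_lines"
  by (simp add: pg2_incidence_graph_def)

lemma pg2_finite_projective_plane:
  "finite_projective_plane (pg2_points :: ('a::{field,finite} ^ 3) set set) pg2_lines (\<subseteq>) (CARD('a))"
  by standard (simp_all add: card_pg2_points card_points_on_line pg2_ex1_line)

section \<open>Upper and lower bounds for the intimacy\<close>

context square_field
begin

interpretation finite_projective_plane "pg2_points :: ('a ^ 3) set set" pg2_lines "(\<subseteq>)" "s\<^sup>2"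
  using pg2_finite_projective_plane[where ?'a = 'a] by (simp add: CARD_eq)

abbreviation G :: "(('a ^ 3) set + ('a ^ 3) set) sgraph" where "G \<equiv> pg2_incidence_graph"

lemma vdegree_pg2:
  assumes "v \<in> vertices G"
  shows "vdegree G v = s\<^sup>2 + 1"
proof -
  have "Inr -` vertices G = pg2_lines" "Inl -` vertices G = pg2_points" by (auto simp: vertices_pg2)
  then show ?thesis
    using assms card_line card_lines_through unfolding vdegree_def
    by (auto simp: vertices_pg2 degree_in_point degree_in_line)
qed

text \<open>One of the two parts has at most half of the vertices, and
  \<open>small_part_degree_bound\<close> applies to it. Parity of the degree supplies the final unit
  for even \<open>s\<close>, parity of \<open>s\<close> itself for odd \<open>s\<close>.\<close>

lemma internal_partition_bound:
  assumes "internal_partition G t A B"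
  shows "2 * t + 1 \<le> int s"
proof -
  have bound: "2 * t + 1 \<le> int s"
    if A: "A \<subseteq> vertices G" "A \<noteq> {}" and small: "card A \<le> s\<^sup>2 * s\<^sup>2 + s\<^sup>2 + 1"
      and deg: "\<And>v. v \<in> A \<Longrightarrow> real (vdegree G v) / 2 + real_of_int t \<le> real (degree_in G A v)" for A
  proof -
    define X Y where "X = Inl -` A" and "Y = Inr -` A"
    have A_eq: "A = X <+> Y"
    proof (intro set_eqI)
      fix v show "v \<in> A \<longleftrightarrow> v \<in> X <+> Y" by (cases v) (auto simp: X_def Y_def)
    qed
    have X: "X \<subseteq> pg2_points" and Y: "Y \<subseteq> pg2_lines" using A(1) by (auto simp: X_def Y_def vertices_pg2)
    \<comment> \<open>For even \<open>s\<close> the degree \<open>s\<^sup>2 + 1\<close> is odd, which improves the degree condition by one half.\<close>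
    define m where "m = (if even s then 2 * t + 1 else 2 * t)"
    have deg': "real (s\<^sup>2) + 1 + real_of_int m \<le> 2 * real (degree_in G A v)" if v: "v \<in> A" for v
    proof -
      have "real (s\<^sup>2 + 1) / 2 + real_of_int t \<le> real (degree_in G A v)"
        using deg[OF v] vdegree_pg2[of v] v A(1) by auto
      then have "real_of_int (int (s\<^sup>2) + 1 + 2 * t) \<le> real_of_int (2 * int (degree_in G A v))"
        by (simp add: field_simps)
      then have le: "int (s\<^sup>2) + 1 + 2 * t \<le> 2 * int (degree_in G A v)" by (simp only: of_int_le_iff)
      have "int (s\<^sup>2) + 1 + m \<le> 2 * int (degree_in G A v)"
      proof (cases "even s")
        case True
        then have "odd (int (s\<^sup>2) + 1 + 2 * t)" by simp
        then have "int (s\<^sup>2) + 1 + 2 * t \<noteq> 2 * int (degree_in G A v)" by presburger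
        then show ?thesis using le True by (simp add: m_def)
      qed (use le in \<open>simp add: m_def\<close>)
      then have "real_of_int (int (s\<^sup>2) + 1 + m) \<le> real_of_int (2 * int (degree_in G A v))"
        by (simp only: of_int_le_iff)
      then show ?thesis by simp
    qed
    have "real_of_int m \<le> real s"
    proof (rule small_part_degree_bound[OF X Y])
      show "0 < real s" using s_ge_2 by simp
      show "(real s)\<^sup>2 = real (s\<^sup>2)" by simp
      show "X \<noteq> {} \<or> Y \<noteq> {}" using A(2) A_eq by auto
      show "card X + card Y \<le> (s\<^sup>2)\<^sup>2 + s\<^sup>2 + 1"
        using small by (simp add: A_eq card_Plus power2_eq_square)
      show "real (s\<^sup>2) + 1 + real_of_int m \<le> 2 * real (card {L \<in> Y. P \<subseteq> L})" if "P \<in> X" for P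
        using deg'[of "Inl P"] degree_in_point[OF _ A(1), of P] X that by (auto simp: X_def Y_def)
      show "real (s\<^sup>2) + 1 + real_of_int m \<le> 2 * real (card {P \<in> X. P \<subseteq> L})" if "L \<in> Y" for L
        using deg'[of "Inr L"] degree_in_line[OF _ A(1), of L] Y that by (auto simp: X_def Y_def)
    qed
    then have "m \<le> int s" by linarith
    then show ?thesis by (auto simp: m_def split: if_splits elim!: oddE)
  qed
  have AB: "A \<union> B = vertices G" "A \<inter> B = {}" "A \<noteq> {}" "B \<noteq> {}"
    and degA: "\<And>v. v \<in> A \<Longrightarrow> real (vdegree G v) / 2 + real_of_int t \<le> real (degree_in G A v)"
    and degB: "\<And>v. v \<in> B \<Longrightarrow> real (vdegree G v) / 2 + real_of_int t \<le> real (degree_in G B v)"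
    using assms by (auto simp: internal_partition_def)
  have "card A + card B = 2 * (s\<^sup>2 * s\<^sup>2 + s\<^sup>2 + 1)"
    using AB(1,2) by (subst card_Un_disjoint[symmetric])
      (auto simp: vertices_pg2 card_Plus card_Pts card_Lns power2_eq_square)
  then have "card A \<le> s\<^sup>2 * s\<^sup>2 + s\<^sup>2 + 1 \<or> card B \<le> s\<^sup>2 * s\<^sup>2 + s\<^sup>2 + 1" by auto
  then show ?thesis
  proof
    assume "card A \<le> s\<^sup>2 * s\<^sup>2 + s\<^sup>2 + 1"
    then show ?thesis using AB degA by (intro bound[of A]) auto
  next
    assume "card B \<le> s\<^sup>2 * s\<^sup>2 + s\<^sup>2 + 1"
    then show ?thesis using AB degB by (intro bound[of B]) auto
  qed
qed

text \<open>Half of the degree is \<open>k + (s + 1) / 2\<close>. The internal degrees are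
  \<open>k + s\<close> in \<open>A\<close> and \<open>k + s + 1\<close> in \<open>B\<close>, so the
  excesses are \<open>(s - 1) / 2\<close> and \<open>(s + 1) / 2\<close>.\<close>

lemma ex_internal_partition: "\<exists>A B. internal_partition G ((int s - 1) div 2) A B"
proof -
  obtain c :: 'a where c: "c ^ s = c" "\<And>x. x ^ 3 \<noteq> x + c" using ex_rootless_cubic by blast
  interpret cubic_extension s ty c by unfold_locales (use c in auto)
  have "even (s * (s - 1))" by auto
  \<comment> \<open>\<open>k = (q - s) / 2\<close> makes the internal degrees \<open>k + s\<close> and \<open>q + 1 - k\<close> almost equal.\<close>
  then obtain k where k: "s * (s - 1) = 2 * k" by blast
  have ks: "s\<^sup>2 = 2 * k + s" using k s_ge_2 by (cases s) (auto simp: power2_eq_square)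
  have k1: "1 \<le> k" using k s_ge_2 by (cases k) auto
  obtain X where X: "X \<subseteq> (pg2_points :: ('a ^ 3) set set)" "card X = k * (s\<^sup>2 + s + 1)"
    and two: "\<And>L. L \<in> pg2_lines \<Longrightarrow> card {P \<in> X. P \<subseteq> L} = k \<or> card {P \<in> X. P \<subseteq> L} = k + s"
    using ex_two_intersection_set[of k] ks by auto
  define Y where "Y = {L \<in> pg2_lines. card {P \<in> X. P \<subseteq> L} = k + s}"
  have Y: "Y \<subseteq> pg2_lines" by (auto simp: Y_def)
  have s0: "s > 0" using s_ge_2 by simp
  have degP: "card {L \<in> Y. P \<subseteq> L} = k + (if P \<in> X then s else 0)" if "P \<in> pg2_points" for P
    unfolding Y_def
    by (rule degree_from_two_intersection_set[OF X(1) _ s0 refl two that]) (use X(2) in simp_all)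
  define A B where "A = X <+> Y" and "B = (pg2_points - X) <+> (pg2_lines - Y)"
  have AV: "A \<subseteq> vertices G" and BV: "B \<subseteq> vertices G"
    using X Y by (auto simp: A_def B_def vertices_pg2)
  have pre: "Inl -` A = X" "Inr -` A = Y" "Inl -` B = pg2_points - X" "Inr -` B = pg2_lines - Y"
    by (auto simp: A_def B_def)
  have compl: "card {x \<in> U - V. R x} = card {x \<in> U. R x} - card {x \<in> V. R x}"
    if "V \<subseteq> U" "finite U" for U V and R :: "('a ^ 3) set \<Rightarrow> bool"
  proof -
    have "{x \<in> U - V. R x} = {x \<in> U. R x} - {x \<in> V. R x}" by auto
    then show ?thesis using that by (simp add: card_Diff_subset finite_subset Collect_mono subset_iff)
  qed
  have degA: "degree_in G A v = k + s" if "v \<in> A" for v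
  proof -
    from that consider P where "v = Inl P" "P \<in> X" | L where "v = Inr L" "L \<in> Y" by (auto simp: A_def)
    then show ?thesis
    proof cases
      case 1
      then show ?thesis using X(1) degP[of P] by (auto simp: degree_in_point[OF _ AV] pre)
    next
      case 2
      then have "L \<in> pg2_lines" "card {P \<in> X. P \<subseteq> L} = k + s" by (auto simp: Y_def)
      then show ?thesis using 2 by (simp add: degree_in_line[OF _ AV] pre)
    qed
  qed
  have degB: "degree_in G B v = s\<^sup>2 + 1 - k" if "v \<in> B" for v
  proof -
    from that consider P where "v = Inl P" "P \<in> pg2_points" "P \<notin> X"
      | L where "v = Inr L" "L \<in> pg2_lines" "L \<notin> Y" by (auto simp: B_def)
    then show ?thesis
    proof cases
      case 1
      then show ?thesis
        using degP[of P] card_lines_through[of P] compl[OF Y, of "\<lambda>L. P \<subseteq> L"]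
        by (simp add: degree_in_point[OF _ BV] pre)
    next
      case 2
      then have "card {P \<in> X. P \<subseteq> L} = k" using two by (auto simp: Y_def)
      then show ?thesis
        using 2 card_line[of L] compl[OF X(1), of "\<lambda>P. P \<subseteq> L"]
        by (simp add: degree_in_line[OF _ BV] pre)
    qed
  qed
  have "X \<noteq> {}" using X(2) k1 by auto
  moreover have "card X \<noteq> card (pg2_points :: ('a ^ 3) set set)"
  proof
    assume "card X = card (pg2_points :: ('a ^ 3) set set)"
    then have "k * (s\<^sup>2 + s + 1) = (2 * k + s) * s\<^sup>2 + s\<^sup>2 + 1"
      using X(2) card_Pts ks by (simp add: power2_eq_square)
    \<comment> \<open>This bounds the size of \<open>X\<close> by \<open>2 * k * s^2\<close>, which
      is below the number of points, so \<open>B\<close> is nonempty.\<close>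
    moreover have "k * (s + 1) \<le> k * s\<^sup>2"
      using k1 s_ge_2 by (intro mult_le_mono2) (simp add: power2_eq_square, cases s, auto)
    ultimately show False using s_ge_2 by (simp add: algebra_simps)
  qed
  ultimately have ne: "A \<noteq> {}" "B \<noteq> {}" using X(1) by (auto simp: A_def B_def)
  have t: "2 * real_of_int ((int s - 1) div 2) \<le> real s - 1" by linarith
  have "internal_partition G ((int s - 1) div 2) A B"
    unfolding internal_partition_def
  proof (intro conjI ballI ne)
    show "A \<union> B = vertices G" "A \<inter> B = {}" using X(1) Y by (auto simp: A_def B_def vertices_pg2)
    have ksr: "real (s\<^sup>2) = 2 * real k + real s" using ks by (metis of_nat_add of_nat_mult of_nat_numeral)
    fix v
    have vd: "real (vdegree G v) = 2 * real k + real s + 1" if "v \<in> vertices G"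
      using vdegree_pg2[OF that] ksr by simp
    show "real (vdegree G v) / 2 + real_of_int ((int s - 1) div 2) \<le> real (degree_in G A v)" if "v \<in> A"
      using degA[OF that] vd subsetD[OF AV that] t by (simp add: field_simps)
    show "real (vdegree G v) / 2 + real_of_int ((int s - 1) div 2) \<le> real (degree_in G B v)" if "v \<in> B"
    proof -
      have "real (s\<^sup>2 + 1 - k) = real k + real s + 1" using ks by simp
      then show ?thesis using degB[OF that] vd subsetD[OF BV that] t by (simp add: field_simps)
    qed
  qed
  then show ?thesis by blast
qed

end

theorem theorem1:
  fixes q :: nat
  assumes "primepow q"
    and "is_square q"
    and "CARD('a::{field,finite}) = q"
  shows "intimacy (pg2_incidence_graph :: (('a ^ 3) set + ('a ^ 3) set) sgraph)
           = \<lfloor>(sqrt (real q) - 1) / 2\<rfloor>"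
proof -
  obtain s where s: "q = s\<^sup>2" using assms(2) by (auto elim: is_nth_powerE)
  interpret square_field s "TYPE('a)" by unfold_locales (use assms s in auto)
  have "intimacy (pg2_incidence_graph :: (('a ^ 3) set + ('a ^ 3) set) sgraph) = (int s - 1) div 2"
  proof -
    obtain A B where "internal_partition (pg2_incidence_graph :: (('a ^ 3) set + ('a ^ 3) set) sgraph)
        ((int s - 1) div 2) A B"
      using ex_internal_partition by blast
    moreover have "t \<le> (int s - 1) div 2"
      if "internal_partition (pg2_incidence_graph :: (('a ^ 3) set + ('a ^ 3) set) sgraph) t A B" for t A B
      using internal_partition_bound[OF that] by linarith
    ultimately show ?thesis by (rule intimacy_eqI)
  qed
  also have "\<dots> = \<lfloor>(sqrt (real q) - 1) / 2\<rfloor>"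
    using s floor_divide_of_int_eq[of "int s - 1" 2, where ?'a = real] by simp
  finally show ?thesis .
qed

end
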